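(* The decision problems $\textsc{MoSm}$ and $\textsc{WoSm}$ are $\mathsf{AC}^0$ many-one reducible to $\textsc{Ccv}\neg$.
   Context: A stable marriage instance consists of $n$ men and $n$ women, each with a preference list totally ordering all persons of the opposite sex. A marriage (perfect matching) $P$ is stable if there are no man $m$ and woman $w$ who each prefer the other to their partner in $P$. The man-optimal (resp. woman-optimal) stable marriage is the stable marriage in which every man (resp. woman) is matched to a partner he (she) likes at least as well as any partner in any stable marriage. $\textsc{MoSm}$ (resp. $\textsc{WoSm}$): given an instance and a designated man-woman pair, decide whether that pair is married in the man-optimal (resp. woman-optimal) stable marriage. $\textsc{Ccv}\neg$: given a comparator circuit which may contain comparator gates (mapping the values $(p,q)$ of two wires to $(p\wedge q,p\vee q)$) and negation gates (flipping the value on one wire), a Boolean input for each wire and a designated wire, decide whether that wire outputs $1$. $A$ is $\mathsf{AC}^0$ many-one reducible to $B$ if there is a uniform $\mathsf{AC}^0$ computable function $F$ with $A(X)\leftrightarrow B(F(X))$. *)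

theory Defs
  imports Main
begin

section \<open>First-order definability over the natural numbers with bounded quantifiers\<close>

datatype trm = Var nat | Zero | One | Plus trm trm | Times trm trm

primrec trm_val :: "(nat \<Rightarrow> nat) \<Rightarrow> trm \<Rightarrow> nat" where
  "trm_val e (Var i) = e i"
| "trm_val e Zero = 0"
| "trm_val e One = 1"
| "trm_val e (Plus s t) = trm_val e s + trm_val e t"
| "trm_val e (Times s t) = trm_val e s * trm_val e t"

datatype fml = Equal trm trm | Leq trm trm | Neg fml | Conj fml fml | BEx nat trm fml

text \<open>\<open>BEx i t f\<close> is the bounded quantification \<open>\<exists>v\<^sub>i < t. f\<close>; the bound \<open>t\<close> is outside the scope
  of the quantified variable.\<close>

primrec sat :: "(nat \<Rightarrow> nat) \<Rightarrow> fml \<Rightarrow> bool" where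
  "sat e (Equal s t) \<longleftrightarrow> trm_val e s = trm_val e t"
| "sat e (Leq s t) \<longleftrightarrow> trm_val e s \<le> trm_val e t"
| "sat e (Neg f) \<longleftrightarrow> \<not> sat e f"
| "sat e (Conj f g) \<longleftrightarrow> sat e f \<and> sat e g"
| "sat e (BEx i t f) \<longleftrightarrow> (\<exists>a < trm_val e t. sat (e(i := a)) f)"

definition definable2 :: "(nat \<Rightarrow> nat \<Rightarrow> bool) \<Rightarrow> bool" where
  "definable2 R \<longleftrightarrow> (\<exists>f. \<forall>e. sat e f \<longleftrightarrow> R (e 0) (e 1))"

definition definable3 :: "(nat \<Rightarrow> nat \<Rightarrow> nat \<Rightarrow> bool) \<Rightarrow> bool" where
  "definable3 R \<longleftrightarrow> (\<exists>f. \<forall>e. sat e f \<longleftrightarrow> R (e 0) (e 1) (e 2))"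


section \<open>Uniform \<open>AC\<^sup>0\<close>\<close>

text \<open>Gates of unbounded fan-in, each listing its predecessors; \<open>And {}\<close> and \<open>Or {}\<close> are the
  Boolean constants.\<close>

datatype gate = Input nat | Not nat | And "nat set" | Or "nat set"

primrec preds :: "gate \<Rightarrow> nat set" where
  "preds (Input i) = {}"
| "preds (Not h) = {h}"
| "preds (And H) = H"
| "preds (Or H) = H"

record circuit =
  num_gates :: nat
  gate_at :: "nat \<Rightarrow> gate"
  outputs :: "nat list"

definition wf_circuit :: "nat \<Rightarrow> circuit \<Rightarrow> bool" where
  "wf_circuit n C \<longleftrightarrow>
     (\<forall>g < num_gates C. preds (gate_at C g) \<subseteq> {..<num_gates C} \<and>
                        (\<forall>i. gate_at C g = Input i \<longrightarrow> i < n)) \<and>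
     set (outputs C) \<subseteq> {..<num_gates C}"

text \<open>All paths ending in gate \<open>g\<close> have length at most \<open>d\<close>. In particular no cycle is reachable
  backwards from such a gate.\<close>

primrec depth_le :: "circuit \<Rightarrow> nat \<Rightarrow> nat \<Rightarrow> bool" where
  "depth_le C 0 g \<longleftrightarrow> preds (gate_at C g) = {}"
| "depth_le C (Suc d) g \<longleftrightarrow> (\<forall>h \<in> preds (gate_at C g). depth_le C d h)"

inductive gate_value :: "circuit \<Rightarrow> bool list \<Rightarrow> nat \<Rightarrow> bool \<Rightarrow> bool" for C x where
  "gate_at C g = Input i \<Longrightarrow> gate_value C x g (x ! i)"
| "gate_at C g = Not h \<Longrightarrow> gate_value C x h b \<Longrightarrow> gate_value C x g (\<not> b)"
| "gate_at C g = And H \<Longrightarrow> \<forall>h\<in>H. gate_value C x h (v h) \<Longrightarrow> gate_value C x g (\<forall>h\<in>H. v h)"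
| "gate_at C g = Or H \<Longrightarrow> \<forall>h\<in>H. gate_value C x h (v h) \<Longrightarrow> gate_value C x g (\<exists>h\<in>H. v h)"

definition computes :: "circuit \<Rightarrow> bool list \<Rightarrow> bool list \<Rightarrow> bool" where
  "computes C x y \<longleftrightarrow> list_all2 (gate_value C x) (outputs C) y"

text \<open>First-order uniformity: the direct connection language of the family (gate types, wires and
  outputs of the \<open>n\<close>-th circuit) is definable by formulas over \<open>+\<close>, \<open>\<times>\<close>, \<open>\<le>\<close> with quantifiers
  bounded by polynomials. For families of polynomial size this coincides with uniformity in the
  sense of the logarithmic time hierarchy and, for constant depth circuits, yields the same
  class as DLOGTIME uniformity (Barrington, Immerman, Straubing).\<close>

definition uniform_family :: "(nat \<Rightarrow> circuit) \<Rightarrow> bool" where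
  "uniform_family Cs \<longleftrightarrow>
     definable2 (\<lambda>n g. g < num_gates (Cs n)) \<and>
     definable3 (\<lambda>n g i. g < num_gates (Cs n) \<and> gate_at (Cs n) g = Input i) \<and>
     definable2 (\<lambda>n g. g < num_gates (Cs n) \<and> (\<exists>h. gate_at (Cs n) g = Not h)) \<and>
     definable2 (\<lambda>n g. g < num_gates (Cs n) \<and> (\<exists>H. gate_at (Cs n) g = And H)) \<and>
     definable2 (\<lambda>n g. g < num_gates (Cs n) \<and> (\<exists>H. gate_at (Cs n) g = Or H)) \<and>
     definable3 (\<lambda>n g h. g < num_gates (Cs n) \<and> h \<in> preds (gate_at (Cs n) g)) \<and>
     definable3 (\<lambda>n j g. j < length (outputs (Cs n)) \<and> outputs (Cs n) ! j = g)"

definition AC0_family :: "(nat \<Rightarrow> circuit) \<Rightarrow> bool" where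
  "AC0_family Cs \<longleftrightarrow>
     (\<forall>n. wf_circuit n (Cs n)) \<and>
     (\<exists>k. \<forall>n. num_gates (Cs n) \<le> n ^ k + k \<and> length (outputs (Cs n)) \<le> n ^ k + k) \<and>
     (\<exists>d. \<forall>n. \<forall>g < num_gates (Cs n). depth_le (Cs n) d g)"

definition uniform_AC0_computable :: "(bool list \<Rightarrow> bool list) \<Rightarrow> bool" where
  "uniform_AC0_computable F \<longleftrightarrow>
     (\<exists>Cs. AC0_family Cs \<and> uniform_family Cs \<and> (\<forall>x. computes (Cs (length x)) x (F x)))"

definition AC0_many_one_reducible :: "bool list set \<Rightarrow> bool list set \<Rightarrow> bool" where
  "AC0_many_one_reducible A B \<longleftrightarrow>
     (\<exists>F. uniform_AC0_computable F \<and> (\<forall>X. X \<in> A \<longleftrightarrow> F X \<in> B))"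


section \<open>Encoding numbers as bit strings\<close>

definition unary :: "nat \<Rightarrow> bool list" where
  "unary k = replicate k True @ [False]"

text \<open>A number below \<open>k\<close> is written in a block of fixed width \<open>k\<close>, so that the position of every
  entry of an encoded instance is a polynomial in the size parameters of the instance.\<close>

definition block :: "nat \<Rightarrow> nat \<Rightarrow> bool list" where
  "block k a = map (\<lambda>i. i = a) [0..<k]"


section \<open>Stable marriage\<close>

text \<open>Men and women are numbered \<open>0, \<dots>, n - 1\<close>; entry \<open>p\<close> of the preference table of one sex is
  the preference list of person \<open>p\<close>, most preferred partner first.\<close>

definition pref_table :: "nat \<Rightarrow> nat list list \<Rightarrow> bool" where
  "pref_table n T \<longleftrightarrow> length T = n \<and> (\<forall>L \<in> set T. distinct L \<and> set L = {..<n})"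

definition prefers :: "nat list list \<Rightarrow> nat \<Rightarrow> nat \<Rightarrow> nat \<Rightarrow> bool" where
  "prefers T p a b \<longleftrightarrow> (\<exists>i j. i < j \<and> j < length (T ! p) \<and> T ! p ! i = a \<and> T ! p ! j = b)"

definition marriage :: "nat \<Rightarrow> (nat \<times> nat) set \<Rightarrow> bool" where
  "marriage n P \<longleftrightarrow> P \<subseteq> {..<n} \<times> {..<n} \<and>
     (\<forall>m<n. \<exists>!w. (m, w) \<in> P) \<and> (\<forall>w<n. \<exists>!m. (m, w) \<in> P)"

definition stable :: "nat \<Rightarrow> nat list list \<Rightarrow> nat list list \<Rightarrow> (nat \<times> nat) set \<Rightarrow> bool" where
  "stable n M W P \<longleftrightarrow> marriage n P \<and>
     \<not> (\<exists>m w m' w'. (m, w') \<in> P \<and> (m', w) \<in> P \<and> prefers M m w w' \<and> prefers W w m m')"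

definition man_optimal :: "nat \<Rightarrow> nat list list \<Rightarrow> nat list list \<Rightarrow> (nat \<times> nat) set \<Rightarrow> bool" where
  "man_optimal n M W P \<longleftrightarrow> stable n M W P \<and>
     (\<forall>Q. stable n M W Q \<longrightarrow>
       (\<forall>m w w'. (m, w) \<in> P \<and> (m, w') \<in> Q \<longrightarrow> w = w' \<or> prefers M m w w'))"

definition woman_optimal :: "nat \<Rightarrow> nat list list \<Rightarrow> nat list list \<Rightarrow> (nat \<times> nat) set \<Rightarrow> bool" where
  "woman_optimal n M W P \<longleftrightarrow> stable n M W P \<and>
     (\<forall>Q. stable n M W Q \<longrightarrow>
       (\<forall>w m m'. (m, w) \<in> P \<and> (m', w) \<in> Q \<longrightarrow> m = m' \<or> prefers W w m m'))"

definition encode_table :: "nat \<Rightarrow> nat list list \<Rightarrow> bool list" where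
  "encode_table n T = concat (map (\<lambda>L. concat (map (block n) L)) T)"

definition encode_marriage_instance ::
    "nat \<Rightarrow> nat list list \<Rightarrow> nat list list \<Rightarrow> nat \<Rightarrow> nat \<Rightarrow> bool list" where
  "encode_marriage_instance n M W m w =
     unary n @ encode_table n M @ encode_table n W @ block n m @ block n w"

definition MoSm :: "bool list set" where
  "MoSm = {encode_marriage_instance n M W m w | n M W m w.
     pref_table n M \<and> pref_table n W \<and> m < n \<and> w < n \<and>
     (\<exists>P. man_optimal n M W P \<and> (m, w) \<in> P)}"

definition WoSm :: "bool list set" where
  "WoSm = {encode_marriage_instance n M W m w | n M W m w.
     pref_table n M \<and> pref_table n W \<and> m < n \<and> w < n \<and>
     (\<exists>P. woman_optimal n M W P \<and> (m, w) \<in> P)}"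


section \<open>Comparator circuits with negation gates\<close>

text \<open>\<open>Comparator i j\<close> puts the conjunction on wire \<open>i\<close> and the disjunction on wire \<open>j\<close>.\<close>

datatype cgate = Comparator nat nat | Negation nat

primrec wf_cgate :: "nat \<Rightarrow> cgate \<Rightarrow> bool" where
  "wf_cgate k (Comparator i j) \<longleftrightarrow> i < k \<and> j < k \<and> i \<noteq> j"
| "wf_cgate k (Negation i) \<longleftrightarrow> i < k"

primrec apply_cgate :: "cgate \<Rightarrow> bool list \<Rightarrow> bool list" where
  "apply_cgate (Comparator i j) v = v[i := v ! i \<and> v ! j, j := v ! i \<or> v ! j]"
| "apply_cgate (Negation i) v = v[i := \<not> v ! i]"

primrec encode_cgate :: "nat \<Rightarrow> cgate \<Rightarrow> bool list" where
  "encode_cgate k (Comparator i j) = False # block k i @ block k j"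
| "encode_cgate k (Negation i) = True # block k i @ replicate k False"

text \<open>The gates are applied in list order to the wires, initially carrying the values \<open>v\<close>;
  \<open>c\<close> is the designated wire.\<close>

definition encode_ccv_instance :: "cgate list \<Rightarrow> bool list \<Rightarrow> nat \<Rightarrow> bool list" where
  "encode_ccv_instance gs v c =
     unary (length v) @ unary (length gs) @ concat (map (encode_cgate (length v)) gs) @
     v @ block (length v) c"

definition CcvNeg :: "bool list set" where
  "CcvNeg = {encode_ccv_instance gs v c | gs v c.
     (\<forall>g \<in> set gs. wf_cgate (length v) g) \<and> c < length v \<and> fold apply_cgate gs v ! c}"

end

theory Submission
  imports Defs
begin

text \<open>In the Gale-Shapley process, let \<open>p(m, w)\<close> say that \<open>m\<close> proposes to \<open>w\<close>, and \<open>h(w, m)\<close>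
  that somebody whom \<open>w\<close> likes better than \<open>m\<close> proposes to her. Then \<open>p(m, w) \<and> h(w, m)\<close> says
  that \<open>m\<close> proposes to his choice after \<open>w\<close>, and \<open>p(m, w) \<or> h(w, m)\<close> that \<open>w\<close> has a proposal
  from \<open>m\<close> or better. So every pair is a comparator, and the process is the least fixed point of
  a cyclic network in which each man runs through the women and each woman through the men in
  order of preference. Every output of a comparator is consumed exactly once, hence unrolling the
  network \<open>2n\<^sup>2\<close> times needs no copying of wires and reaches the fixed point. The pair
  \<open>(m, w)\<close> is married in the man-optimal marriage iff \<open>p(m, w) \<and> \<not> h(w, m)\<close>.

  As wires are encoded by one-hot blocks, the preference tables can be copied into the
  addresses of the gates. So the reduction is a projection: each output bit is a constant or an
  input bit, and the only work left for uniformity is to define the map from output to input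
  positions. Malformed inputs need no separate test: they yield malformed circuits. Exchanging
  the two sexes in the input gives the woman-optimal case.\<close>

section \<open>Definability\<close>

text \<open>The state of the process consists of \<open>2 * n * n\<close> Booleans and can only
  grow, which is where the number of rounds comes from. It yields the man-optimal marriage because
  every rejection in it is forced: for a stable marriage \<open>Q\<close>, the first man rejected by
  his \<open>Q\<close>-partner would be displaced by a man who blocks \<open>Q\<close> together with
  her. The tables are read in two ways. A round needs the rank of a fixed partner, a column of a
  person's table; sorting the final state by partners needs the partner at a fixed rank, a row. Both
  are one-hot strings of the input if the lists are permutations, and can be copied into addresses.
  Conversely, a circuit built in this way is well formed only if all rows and columns are one-hot,
  which forces every list to be a permutation. The size field is checked through the type bits of
  the gates, the designated woman through a gate address, and the designated man through the
  designated wire. The one quantity that is computed rather than copied is \<open>n\<close>, as the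
  inverse of the strictly increasing length of an encoding; all other lengths are sent to the empty
  string, which encodes no circuit.\<close>

primrec trm_rename :: "(nat \<Rightarrow> nat) \<Rightarrow> trm \<Rightarrow> trm" where
  "trm_rename r (Var i) = Var (r i)"
| "trm_rename r Zero = Zero"
| "trm_rename r One = One"
| "trm_rename r (Plus s t) = Plus (trm_rename r s) (trm_rename r t)"
| "trm_rename r (Times s t) = Times (trm_rename r s) (trm_rename r t)"

primrec fml_rename :: "(nat \<Rightarrow> nat) \<Rightarrow> fml \<Rightarrow> fml" where
  "fml_rename r (Equal s t) = Equal (trm_rename r s) (trm_rename r t)"
| "fml_rename r (Leq s t) = Leq (trm_rename r s) (trm_rename r t)"
| "fml_rename r (Neg f) = Neg (fml_rename r f)"
| "fml_rename r (Conj f g) = Conj (fml_rename r f) (fml_rename r g)"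
| "fml_rename r (BEx i t f) = BEx (r i) (trm_rename r t) (fml_rename r f)"

lemma trm_val_rename: "trm_val e (trm_rename r t) = trm_val (\<lambda>i. e (r i)) t"
  by (induction t) auto

text \<open>Injectivity prevents capture: a renamed bound variable stays different from all other
  renamed variables.\<close>

lemma sat_rename: "inj r \<Longrightarrow> sat e (fml_rename r f) \<longleftrightarrow> sat (\<lambda>i. e (r i)) f"
proof (induction f arbitrary: e)
  case (BEx i t f)
  have "(\<lambda>j. (e(r i := a)) (r j)) = (\<lambda>j. e (r j))(i := a)" for a
    using BEx.prems by (simp add: fun_eq_iff inj_eq)
  then show ?case using BEx by (simp add: trm_val_rename)
qed (auto simp: trm_val_rename)

primrec trm_bound :: "trm \<Rightarrow> nat" where
  "trm_bound (Var i) = Suc i"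
| "trm_bound Zero = 0"
| "trm_bound One = 0"
| "trm_bound (Plus s t) = max (trm_bound s) (trm_bound t)"
| "trm_bound (Times s t) = max (trm_bound s) (trm_bound t)"

text \<open>Bound variables are counted like free ones. The purpose is only to have an index from
  which on all variables are fresh.\<close>

primrec fml_bound :: "fml \<Rightarrow> nat" where
  "fml_bound (Equal s t) = max (trm_bound s) (trm_bound t)"
| "fml_bound (Leq s t) = max (trm_bound s) (trm_bound t)"
| "fml_bound (Neg f) = fml_bound f"
| "fml_bound (Conj f g) = max (fml_bound f) (fml_bound g)"
| "fml_bound (BEx i t f) = max (trm_bound t) (fml_bound f)"

lemma trm_val_cong: "\<forall>i<trm_bound t. e i = e' i \<Longrightarrow> trm_val e t = trm_val e' t"
  by (induction t) auto

lemma sat_cong: "\<forall>i<fml_bound f. e i = e' i \<Longrightarrow> sat e f \<longleftrightarrow> sat e' f"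
proof (induction f arbitrary: e e')
  case (Equal s t)
  then have "trm_val e s = trm_val e' s" "trm_val e t = trm_val e' t"
    by (auto intro!: trm_val_cong)
  then show ?case by simp
next
  case (Leq s t)
  then have "trm_val e s = trm_val e' s" "trm_val e t = trm_val e' t"
    by (auto intro!: trm_val_cong)
  then show ?case by simp
next
  case (Neg f)
  then have "sat e f \<longleftrightarrow> sat e' f" by (intro Neg.IH) simp
  then show ?case by simp
next
  case (Conj f g)
  then have "sat e f \<longleftrightarrow> sat e' f" "sat e g \<longleftrightarrow> sat e' g"
    by (intro Conj.IH; simp)+
  then show ?case by simp
next
  case (BEx j t f)
  then have "trm_val e t = trm_val e' t" by (intro trm_val_cong) simp
  moreover have "sat (e(j := c)) f = sat (e'(j := c)) f" for c
    using BEx.prems by (intro BEx.IH) simp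
  ultimately show ?case by simp
qed

section \<open>Definable predicates and functions on environments, and their closure
  properties\<close>

definition definable :: "((nat \<Rightarrow> nat) \<Rightarrow> bool) \<Rightarrow> bool" where
  "definable P \<longleftrightarrow> (\<exists>f. \<forall>e. sat e f \<longleftrightarrow> P e)"

text \<open>A definable graph alone would not allow substitution, since quantifiers are bounded; the
  dominating term supplies the bound. In the graph, variable 0 is the value and the arguments are
  shifted by one. Taking whole environments as arguments makes the closure rules independent of
  arity.\<close>

definition definable_fun :: "((nat \<Rightarrow> nat) \<Rightarrow> nat) \<Rightarrow> bool" where
  "definable_fun h \<longleftrightarrow> (\<exists>t. \<forall>e. h e \<le> trm_val e t) \<and> definable (\<lambda>e. h (\<lambda>i. e (Suc i)) = e 0)"

lemma definable_not: "definable P \<Longrightarrow> definable (\<lambda>e. \<not> P e)"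
proof -
  assume "definable P"
  then obtain f where "\<forall>e. sat e f \<longleftrightarrow> P e" unfolding definable_def ..
  then have "\<forall>e. sat e (Neg f) \<longleftrightarrow> \<not> P e" by simp
  then show ?thesis unfolding definable_def ..
qed

lemma definable_conj: "definable P \<Longrightarrow> definable Q \<Longrightarrow> definable (\<lambda>e. P e \<and> Q e)"
proof -
  assume "definable P" "definable Q"
  then obtain f g where "\<forall>e. sat e f \<longleftrightarrow> P e" "\<forall>e. sat e g \<longleftrightarrow> Q e"
    unfolding definable_def by (elim exE)
  then have "\<forall>e. sat e (Conj f g) \<longleftrightarrow> P e \<and> Q e" by simp
  then show ?thesis unfolding definable_def ..
qed

lemma definable_disj: "definable P \<Longrightarrow> definable Q \<Longrightarrow> definable (\<lambda>e. P e \<or> Q e)"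
  using definable_not[OF definable_conj[OF definable_not definable_not], of P Q] by simp

lemma definable_const: "definable (\<lambda>e. b)"
proof -
  have "definable (\<lambda>e. True)"
    unfolding definable_def by (rule exI[of _ "Equal Zero Zero"]) simp
  then show ?thesis using definable_not[of "\<lambda>e. True"] by (cases b) auto
qed

lemma definable_rename: "definable P \<Longrightarrow> inj r \<Longrightarrow> definable (\<lambda>e. P (\<lambda>i. e (r i)))"
proof -
  assume P: "definable P" and r: "inj r"
  from P obtain f where "\<forall>e. sat e f = P e" unfolding definable_def ..
  then have "\<forall>e. sat e (fml_rename r f) = P (\<lambda>i. e (r i))" by (simp add: sat_rename[OF r])
  then show ?thesis unfolding definable_def ..
qed

lemma definable_trm_eq: "definable (\<lambda>e. trm_val e s = trm_val e t)"
  unfolding definable_def by (rule exI[of _ "Equal s t"]) simp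

lemma definable_trm_le: "definable (\<lambda>e. trm_val e s \<le> trm_val e t)"
  unfolding definable_def by (rule exI[of _ "Leq s t"]) simp

text \<open>The premise reads \<open>Q\<close> in de Bruijn style: the quantified variable is variable 0 and all
  others are shifted. The cyclic renaming of the proof moves it to a fresh name.\<close>

lemma definable_ex_less_trm:
  assumes "definable (\<lambda>e. Q (\<lambda>i. e (Suc i)) (e 0))"
  shows "definable (\<lambda>e. \<exists>a<trm_val e t. Q e a)"
proof -
  from assms obtain f where f: "\<forall>e. sat e f \<longleftrightarrow> Q (\<lambda>i. e (Suc i)) (e 0)"
    unfolding definable_def ..
  define k where "k = fml_bound f"
  define r where "r j = (if j = 0 then k else if j \<le> k then j - 1 else j)" for j
  have "inj r" by (auto simp: inj_def r_def split: if_splits)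
  moreover have "sat (\<lambda>j. (e(k := a)) (r j)) f \<longleftrightarrow> Q e a" for e a
  proof -
    have "sat (\<lambda>j. (e(k := a)) (r j)) f \<longleftrightarrow> sat (\<lambda>j. if j = 0 then a else e (j - 1)) f"
      by (rule sat_cong) (auto simp: r_def k_def[symmetric])
    then show ?thesis by (simp add: f)
  qed
  ultimately have "\<forall>e. sat e (BEx k t (fml_rename r f)) \<longleftrightarrow> (\<exists>a<trm_val e t. Q e a)"
    by (simp add: sat_rename)
  then show ?thesis unfolding definable_def ..
qed

text \<open>A bounded search finds the value \<open>a = h e\<close> and passes it to
  \<open>Q\<close>. The bound is strict, hence the added \<open>One\<close>.\<close>

lemma definable_subst:
  assumes "definable_fun h" "definable (\<lambda>e. Q (\<lambda>i. e (Suc i)) (e 0))"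
  shows "definable (\<lambda>e. Q e (h e))"
proof -
  from assms(1) obtain t where t: "\<forall>e. h e \<le> trm_val e t"
    unfolding definable_fun_def by (elim conjE exE)
  have "definable (\<lambda>e. \<exists>a<trm_val e (Plus t One). h e = a \<and> Q e a)"
    using assms by (intro definable_ex_less_trm definable_conj) (auto simp: definable_fun_def)
  also have "(\<lambda>e. \<exists>a<trm_val e (Plus t One). h e = a \<and> Q e a) = (\<lambda>e. Q e (h e))"
    using t by (auto simp: fun_eq_iff less_Suc_eq_le)
  finally show ?thesis .
qed

lemma definable_shift: "definable P \<Longrightarrow> definable (\<lambda>e. P (\<lambda>i. e (Suc i)))"
  by (rule definable_rename) simp_all

lemma definable_fun_shift:
  assumes "definable_fun h" shows "definable_fun (\<lambda>e. h (\<lambda>i. e (Suc i)))"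
proof -
  from assms(1) obtain t where t: "\<forall>e. h e \<le> trm_val e t"
    unfolding definable_fun_def by (elim conjE exE)
  \<comment> \<open>Variable 0 is the value in the graph and has to stay; only the arguments
    move.\<close>
  define r where "r j = (if j = 0 then 0 else Suc j)" for j
  have r: "inj r" by (auto simp: r_def inj_def split: if_splits)
  have "definable (\<lambda>e. h (\<lambda>i. e (r (Suc i))) = e (r 0))"
    using assms(1) definable_rename[OF _ r, of "\<lambda>e. h (\<lambda>i. e (Suc i)) = e 0"]
    unfolding definable_fun_def by (elim conjE)
  then have "definable (\<lambda>e. h (\<lambda>i. e (Suc (Suc i))) = e 0)"
    by (simp add: r_def)
  moreover have "\<forall>e. h (\<lambda>i. e (Suc i)) \<le> trm_val e (trm_rename Suc t)"
    using t by (simp add: trm_val_rename)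
  ultimately show ?thesis unfolding definable_fun_def by (intro conjI exI)
qed

lemma definable_fun_trm: "definable_fun (\<lambda>e. trm_val e t)"
  unfolding definable_fun_def
  using definable_trm_eq[of "trm_rename Suc t" "Var 0"] by (auto simp: trm_val_rename)

lemma definable_fun_var: "definable_fun (\<lambda>e. e i)"
  using definable_fun_trm[of "Var i"] by simp

lemma definable_fun_const: "definable_fun (\<lambda>e. c)"
proof -
  have "\<exists>t. \<forall>e. trm_val e t = c"
  proof (induction c)
    case 0
    show ?case by (rule exI[of _ Zero]) simp
  next
    case (Suc c)
    then obtain t where "\<forall>e. trm_val e t = c" by blast
    then show ?case by (intro exI[of _ "Plus t One"]) simp
  qed
  then obtain t where "\<forall>e. trm_val e t = c" ..
  then show ?thesis using definable_fun_trm[of t] by simp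
qed

lemma definable_subst2:
  assumes "definable_fun g" "definable_fun h"
    "definable (\<lambda>e. Q (\<lambda>i. e (Suc (Suc i))) (e 1) (e 0))"
  shows "definable (\<lambda>e. Q e (g e) (h e))"
proof (rule definable_subst[where Q = "\<lambda>e x. Q e x (h e)", OF assms(1)])
  have "definable_fun (\<lambda>e. h (\<lambda>i. e (Suc i)))"
    using assms(2) by (rule definable_fun_shift)
  from definable_subst[where Q = "\<lambda>e. Q (\<lambda>i. e (Suc i)) (e 0)", OF this] assms(3)
  show "definable (\<lambda>e. Q (\<lambda>i. e (Suc i)) (e 0) (h (\<lambda>i. e (Suc i))))"
    by (simp only: One_nat_def)
qed

lemma definable_eq: "definable_fun g \<Longrightarrow> definable_fun h \<Longrightarrow> definable (\<lambda>e. g e = h e)"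
  by (rule definable_subst2[where Q = "\<lambda>_ x y. x = y"], assumption+)
    (use definable_trm_eq[of "Var 1" "Var 0"] in simp)

lemma definable_le: "definable_fun g \<Longrightarrow> definable_fun h \<Longrightarrow> definable (\<lambda>e. g e \<le> h e)"
  by (rule definable_subst2[where Q = "\<lambda>_ x y. x \<le> y"], assumption+)
    (use definable_trm_le[of "Var 1" "Var 0"] in simp)

lemma definable_less: "definable_fun g \<Longrightarrow> definable_fun h \<Longrightarrow> definable (\<lambda>e. g e < h e)"
  using definable_not[OF definable_le] by (simp add: not_le)

text \<open>The quantifier runs up to a term that dominates \<open>h\<close>, and the exact bound
  \<open>a < h e\<close> moves into the formula.\<close>

lemma definable_ex_less:
  assumes "definable_fun h" "definable (\<lambda>e. Q (\<lambda>i. e (Suc i)) (e 0))"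
  shows "definable (\<lambda>e. \<exists>a<h e. Q e a)"
proof -
  from assms(1) obtain t where t: "\<forall>e. h e \<le> trm_val e t"
    unfolding definable_fun_def by (elim conjE exE)
  have "definable (\<lambda>e. \<exists>a<trm_val e t. a < h e \<and> Q e a)"
    by (intro definable_ex_less_trm definable_conj definable_less definable_fun_var
        definable_fun_shift assms)
  also have "(\<lambda>e. \<exists>a<trm_val e t. a < h e \<and> Q e a) = (\<lambda>e. \<exists>a<h e. Q e a)"
    using t by (auto simp: fun_eq_iff intro: less_le_trans)
  finally show ?thesis .
qed

lemma definable_funI:
  assumes "definable_fun b" "\<And>e. h e \<le> b e" "definable (\<lambda>e. h (\<lambda>i. e (Suc i)) = e 0)"
  shows "definable_fun h"
proof -
  from assms(1) obtain t where "\<forall>e. b e \<le> trm_val e t"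
    unfolding definable_fun_def by (elim conjE exE)
  with assms(2) have "\<forall>e. h e \<le> trm_val e t" using le_trans by blast
  with assms(3) show ?thesis unfolding definable_fun_def by (intro conjI exI)
qed

lemma definable_fun_plus:
  assumes "definable_fun g" "definable_fun h" shows "definable_fun (\<lambda>e. g e + h e)"
proof -
  from assms obtain s t where "\<forall>e. g e \<le> trm_val e s" "\<forall>e. h e \<le> trm_val e t"
    unfolding definable_fun_def by (elim conjE exE)
  then have "\<forall>e. g e + h e \<le> trm_val e (Plus s t)" by (simp add: add_mono)
  moreover have "definable (\<lambda>e. g (\<lambda>i. e (Suc i)) + h (\<lambda>i. e (Suc i)) = e 0)"
    by (rule definable_subst2[where Q = "\<lambda>e x y. x + y = e 0", OF definable_fun_shift[OF assms(1)] definable_fun_shift[OF assms(2)]])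
      (use definable_trm_eq[of "Plus (Var 1) (Var 0)" "Var 2"] in \<open>simp add: numeral_2_eq_2\<close>)
  ultimately show ?thesis unfolding definable_fun_def by (intro conjI exI)
qed

lemma definable_fun_times:
  assumes "definable_fun g" "definable_fun h" shows "definable_fun (\<lambda>e. g e * h e)"
proof -
  from assms obtain s t where "\<forall>e. g e \<le> trm_val e s" "\<forall>e. h e \<le> trm_val e t"
    unfolding definable_fun_def by (elim conjE exE)
  then have "\<forall>e. g e * h e \<le> trm_val e (Times s t)" by (simp add: mult_mono)
  moreover have "definable (\<lambda>e. g (\<lambda>i. e (Suc i)) * h (\<lambda>i. e (Suc i)) = e 0)"
    by (rule definable_subst2[where Q = "\<lambda>e x y. x * y = e 0", OF definable_fun_shift[OF assms(1)] definable_fun_shift[OF assms(2)]])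
      (use definable_trm_eq[of "Times (Var 1) (Var 0)" "Var 2"] in \<open>simp add: numeral_2_eq_2\<close>)
  ultimately show ?thesis unfolding definable_fun_def by (intro conjI exI)
qed

lemmas definable_basic_intros =
  definable_not definable_conj definable_disj definable_eq definable_le definable_less
  definable_ex_less definable_fun_var definable_fun_plus definable_fun_times definable_const
  definable_fun_const

lemma definable_fun_minus:
  assumes "definable_fun g" "definable_fun h" shows "definable_fun (\<lambda>e. g e - h e)"
proof (rule definable_funI[OF assms(1)])
  have eq: "x - y = z \<longleftrightarrow> (x = y + z \<or> x \<le> y \<and> z = 0)" for x y z :: nat by auto
  show "definable (\<lambda>e. g (\<lambda>i. e (Suc i)) - h (\<lambda>i. e (Suc i)) = e 0)"
    unfolding eq
    by (intro definable_basic_intros definable_fun_shift assms)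
qed auto

lemma definable_fun_div:
  assumes "definable_fun g" "definable_fun h" shows "definable_fun (\<lambda>e. g e div h e)"
proof (rule definable_funI[OF assms(1)])
  \<comment> \<open>The first disjunct is the HOL convention for division by 0; otherwise the
    remainder is found by a search below the divisor.\<close>
  have eq: "x div y = z \<longleftrightarrow> (y = 0 \<and> z = 0 \<or> (\<exists>r<y. x = z * y + r))" for x y z :: nat
    by (cases "y = 0") (auto intro: exI[of _ "x mod y"])
  show "definable (\<lambda>e. g (\<lambda>i. e (Suc i)) div h (\<lambda>i. e (Suc i)) = e 0)"
    unfolding eq
    by (intro definable_basic_intros definable_fun_shift assms)
qed auto

lemma definable_fun_mod:
  assumes "definable_fun g" "definable_fun h" shows "definable_fun (\<lambda>e. g e mod h e)"
  using definable_fun_minus[OF assms(1) definable_fun_times[OF definable_fun_div[OF assms] assms(2)]]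
  by (simp add: minus_div_mult_eq_mod)

lemma definable_fun_if:
  assumes "definable P" "definable_fun g" "definable_fun h"
  shows "definable_fun (\<lambda>e. if P e then g e else h e)"
proof (rule definable_funI[OF definable_fun_plus[OF assms(2,3)]])
  have "definable (\<lambda>e. (P (\<lambda>i. e (Suc i)) \<and> g (\<lambda>i. e (Suc i)) = e 0) \<or>
     (\<not> P (\<lambda>i. e (Suc i)) \<and> h (\<lambda>i. e (Suc i)) = e 0))"
    by (intro definable_basic_intros definable_fun_shift definable_shift assms)
  also have "(\<lambda>e. (P (\<lambda>i. e (Suc i)) \<and> g (\<lambda>i. e (Suc i)) = e 0) \<or>
     (\<not> P (\<lambda>i. e (Suc i)) \<and> h (\<lambda>i. e (Suc i)) = e 0)) =
     (\<lambda>e. (if P (\<lambda>i. e (Suc i)) then g (\<lambda>i. e (Suc i)) else h (\<lambda>i. e (Suc i))) = e 0)"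
    by auto
  finally show "definable (\<lambda>e. (if P (\<lambda>i. e (Suc i)) then g (\<lambda>i. e (Suc i))
     else h (\<lambda>i. e (Suc i))) = e 0)" .
qed auto

lemmas definable_intros =
  definable_basic_intros definable_fun_minus definable_fun_div definable_fun_mod definable_fun_if

text \<open>As \<open>s\<close> lies above the identity, a preimage of \<open>y\<close> is at most
  \<open>y\<close>. So membership in the range is a bounded search, and the inverse is bounded by
  its argument. This serves to recover the size of an instance from its length.\<close>

lemma definable_fun_preimage:
  assumes "\<And>x. x \<le> s x" "inj s" "definable_fun (\<lambda>e. s (e 0))" "definable_fun h"
  shows "definable_fun (\<lambda>e. if h e \<in> range s then inv s (h e) else 0)"
proof (rule definable_funI[OF assms(4)])
  have eq: "(if y \<in> range s then inv s y else 0) = x \<longleftrightarrow>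
     (s x = y \<or> x = 0 \<and> \<not> (\<exists>z<y+1. s z = y))" for x y
  proof (cases "y \<in> range s")
    case True
    then obtain x' where y: "y = s x'" by blast
    then show ?thesis using assms(1)[of x'] assms(2) by (auto simp: inj_eq less_Suc_eq_le)
  qed auto
  have s: "definable (\<lambda>e. s (e i) = y e)" if "definable_fun y" for i y
    by (rule definable_subst[where Q = "\<lambda>e x. s x = y e", OF definable_fun_var])
      (intro definable_eq assms definable_fun_shift that)
  show "definable (\<lambda>e. (if h (\<lambda>i. e (Suc i)) \<in> range s then inv s (h (\<lambda>i. e (Suc i))) else 0) = e 0)"
    unfolding eq
    by (intro definable_disj definable_conj definable_not definable_eq definable_ex_less s
        definable_intros definable_fun_shift assms)
qed (use assms(1,2) in auto)

section \<open>Polynomial growth of definable functions\<close>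

lemma power_le_power_add: "\<exists>k'. \<forall>n. (n + 2) ^ k \<le> n ^ k' + (k' :: nat)"
proof (rule exI[of _ "2 * k + 3 ^ k"], rule allI)
  fix n :: nat
  show "(n + 2) ^ k \<le> n ^ (2 * k + 3 ^ k) + (2 * k + 3 ^ k)"
  proof (cases "n \<le> 1")
    case True
    then have "(n + 2) ^ k \<le> 3 ^ k" by (intro power_mono) auto
    then show ?thesis by simp
  next
    case False
    then have "n + 2 \<le> 2 * n" "2 * n \<le> n * n" by auto
    then have "n + 2 \<le> n ^ 2" unfolding power2_eq_square by (rule le_trans)
    then have "(n + 2) ^ k \<le> (n ^ 2) ^ k" by (intro power_mono) auto
    also have "\<dots> = n ^ (2 * k)" by (simp add: power_mult)
    also have "\<dots> \<le> n ^ (2 * k + 3 ^ k)" using False by (intro power_increasing) auto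
    finally show ?thesis by simp
  qed
qed

text \<open>The base \<open>n + 2\<close> is at least 2, so that one more factor absorbs the
  doubling caused by a sum. \<open>power_le_power_add\<close> then gives the form
  \<open>n ^ k + k\<close> that \<open>AC0_family\<close> asks for: \<open>n + 2\<close> is at most
  \<open>n ^ 2\<close> from 2 on, and the additive constant covers 0 and 1.\<close>

lemma trm_val_poly_bound: "\<exists>k. \<forall>n. trm_val (\<lambda>_. n) t \<le> (n + 2) ^ k"
proof (induction t)
  case (Var i)
  show ?case by (rule exI[of _ 1]) simp
next
  case (Plus s t)
  then obtain a b where ab: "\<forall>n. trm_val (\<lambda>_. n) s \<le> (n + 2) ^ a"
    "\<forall>n. trm_val (\<lambda>_. n) t \<le> (n + 2) ^ b" by blast
  have "trm_val (\<lambda>_. n) (Plus s t) \<le> (n + 2) ^ (a + b + 1)" for n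
  proof -
    have "(n + 2) ^ a \<le> (n + 2) ^ (a + b)" "(n + 2) ^ b \<le> (n + 2) ^ (a + b)"
      by (intro power_increasing; simp)+
    then have "trm_val (\<lambda>_. n) (Plus s t) \<le> 2 * (n + 2) ^ (a + b)"
      using ab[rule_format, of n] unfolding trm_val.simps by linarith
    also have "\<dots> \<le> (n + 2) * (n + 2) ^ (a + b)" by (rule mult_right_mono) auto
    finally show ?thesis by simp
  qed
  then show ?case by blast
next
  case (Times s t)
  then obtain a b where ab: "\<forall>n. trm_val (\<lambda>_. n) s \<le> (n + 2) ^ a"
    "\<forall>n. trm_val (\<lambda>_. n) t \<le> (n + 2) ^ b" by blast
  then have "trm_val (\<lambda>_. n) (Times s t) \<le> (n + 2) ^ (a + b)" for n
    by (simp add: power_add mult_mono)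
  then show ?case by blast
qed auto

lemma definable_fun_poly_bound:
  assumes "definable_fun (\<lambda>e. h (e 0))" shows "\<exists>k. \<forall>n. h n \<le> n ^ k + k"
proof -
  from assms obtain t where t: "\<forall>e. h (e 0) \<le> trm_val e t"
    unfolding definable_fun_def by (elim conjE exE)
  \<comment> \<open>As \<open>h\<close> reads variable 0 only, the dominating term may be evaluated
    in the environment that is constantly \<open>n\<close>.\<close>
  obtain k where "\<forall>n. trm_val (\<lambda>_. n) t \<le> (n + 2) ^ k"
    using trm_val_poly_bound by blast
  then have "\<forall>n. h n \<le> (n + 2) ^ k" using t le_trans by blast
  then show ?thesis using power_le_power_add[of k] le_trans by meson
qed

section \<open>Projections\<close>

text \<open>Sources are numbered like the gates of \<open>projection_gate\<close>. Reading past the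
  end of the input yields False, so that every number is a legal source.\<close>

definition source_bit :: "bool list \<Rightarrow> nat \<Rightarrow> bool" where
  "source_bit X i \<longleftrightarrow> i = 1 \<or> 2 \<le> i \<and> i - 2 < length X \<and> X ! (i - 2)"

definition projection_gate :: "nat \<Rightarrow> gate" where
  "projection_gate g = (if g = 0 then Or {} else if g = 1 then And {} else Input (g - 2))"

text \<open>The circuit has a gate for each input bit and two for the constants, all of depth 0, and
  its outputs just list such gates. Uniformity therefore comes down to the definability of
  \<open>L\<close> and \<open>src\<close>.\<close>

lemma projection_uniform_AC0:
  assumes L: "definable_fun (\<lambda>e. L (e 0))" and src: "definable_fun (\<lambda>e. src (e 0) (e 1))"
  shows "uniform_AC0_computable (\<lambda>X. map (\<lambda>j. source_bit X (src (length X) j)) [0..<L (length X)])"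
proof -
  \<comment> \<open>Sources past the input are redirected to gate 0, the constant False. This keeps
    the circuit well formed and agrees with \<open>source_bit\<close>.\<close>
  define clamp where "clamp n j = (if src n j < n + 2 then src n j else 0)" for n j
  define Cs where "Cs n = \<lparr>num_gates = n + 2, gate_at = projection_gate,
    outputs = map (clamp n) [0..<L n]\<rparr>" for n
  have preds: "preds (projection_gate g) = {}" for g by (auto simp: projection_gate_def)
  have "AC0_family Cs"
    unfolding AC0_family_def
  proof (intro conjI allI)
    show "wf_circuit n (Cs n)" for n
      by (auto simp: wf_circuit_def Cs_def preds clamp_def) (auto simp: projection_gate_def split: if_splits)
    \<comment> \<open>Bounding the sum gives a common exponent for the number of gates and the
      number of outputs.\<close>
    have "definable_fun (\<lambda>e. (e 0 + 2) + L (e 0))" by (intro definable_intros L)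
    then obtain k where k: "\<forall>n. (n + 2) + L n \<le> n ^ k + k"
      using definable_fun_poly_bound[where h = "\<lambda>n. (n + 2) + L n"] by auto
    have "num_gates (Cs n) \<le> n ^ k + k \<and> length (outputs (Cs n)) \<le> n ^ k + k" for n
      using k[rule_format, of n] by (simp add: Cs_def)
    then show "\<exists>k. \<forall>n. num_gates (Cs n) \<le> n ^ k + k \<and> length (outputs (Cs n)) \<le> n ^ k + k" by blast
    show "\<exists>d. \<forall>n. \<forall>g<num_gates (Cs n). depth_le (Cs n) d g"
      by (rule exI[of _ 0]) (simp add: Cs_def preds)
  qed
  moreover have "uniform_family Cs"
  proof -
    have clamp: "definable_fun (\<lambda>e. clamp (e 0) (e 1))"
      unfolding clamp_def by (intro definable_intros src)
    have g: "projection_gate g = Input i \<longleftrightarrow> g = i + 2"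
      "(\<exists>h. projection_gate g = Not h) \<longleftrightarrow> False"
      "(\<exists>H. projection_gate g = And H) \<longleftrightarrow> g = 1"
      "(\<exists>H. projection_gate g = Or H) \<longleftrightarrow> g = 0" for g i
      by (auto simp: projection_gate_def)
    have out: "(j < length (outputs (Cs n)) \<and> outputs (Cs n) ! j = h) = (j < L n \<and> clamp n j = h)"
      for n j h by (auto simp: Cs_def)
    have Cs: "num_gates (Cs n) = n + 2" "gate_at (Cs n) = projection_gate" for n
      by (simp_all add: Cs_def)
    show ?thesis
      unfolding uniform_family_def definable2_def definable3_def out
      unfolding definable_def[symmetric] Cs g preds empty_iff
      by (intro conjI definable_intros clamp L)
  qed
  moreover have "computes (Cs (length X)) X (map (\<lambda>j. source_bit X (src (length X) j)) [0..<L (length X)])" for X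
  proof -
    have "gate_value (Cs (length X)) X (clamp (length X) j) (source_bit X (src (length X) j))" for j
    proof -
      have 0: "gate_value (Cs (length X)) X 0 False"
        using gate_value.intros(4)[of "Cs (length X)" 0 "{}" X] by (simp add: Cs_def projection_gate_def)
      have 1: "gate_value (Cs (length X)) X (Suc 0) True"
        using gate_value.intros(3)[of "Cs (length X)" 1 "{}" X] by (simp add: Cs_def projection_gate_def)
      have "gate_value (Cs (length X)) X (Suc (Suc i)) (X ! i)" for i
        by (intro gate_value.intros(1)) (simp add: Cs_def projection_gate_def)
      then show ?thesis using 0 1
        by (cases "src (length X) j"; cases "src (length X) j - 1")
          (auto simp: clamp_def source_bit_def)
    qed
    then show ?thesis by (auto simp: computes_def Cs_def list_all2_conv_all_nth)
  qed
  ultimately show ?thesis unfolding uniform_AC0_computable_def by blast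
qed

section \<open>Deferred acceptance\<close>

definition rank :: "nat list \<Rightarrow> nat \<Rightarrow> nat" where
  "rank L q = (THE r. r < length L \<and> L ! r = q)"

lemma pref_table_row:
  assumes "pref_table n T" "p < n"
  shows "length (T ! p) = n" "distinct (T ! p)" "set (T ! p) = {..<n}"
proof -
  have "T ! p \<in> set T" using assms by (auto simp: pref_table_def)
  then show "distinct (T ! p)" "set (T ! p) = {..<n}" using assms by (auto simp: pref_table_def)
  then show "length (T ! p) = n" using distinct_card by fastforce
qed

lemma rank_nth: "distinct L \<Longrightarrow> r < length L \<Longrightarrow> rank L (L ! r) = r"
  unfolding rank_def by (rule the_equality) (auto simp: nth_eq_iff_index_eq)

lemma pref_table_nth_less:
  "pref_table n T \<Longrightarrow> p < n \<Longrightarrow> r < n \<Longrightarrow> T ! p ! r < n"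
  using pref_table_row[of n T p] nth_mem[of r "T ! p"] by auto

lemma pref_table_rank_nth:
  "pref_table n T \<Longrightarrow> p < n \<Longrightarrow> r < n \<Longrightarrow> rank (T ! p) (T ! p ! r) = r"
  using pref_table_row[of n T p] by (simp add: rank_nth)

lemma pref_table_rank:
  assumes "pref_table n T" "p < n" "q < n"
  shows "rank (T ! p) q < n" "T ! p ! rank (T ! p) q = q"
proof -
  note row = pref_table_row[OF assms(1,2)]
  then obtain r where "r < n" "T ! p ! r = q" using assms(3) by (metis in_set_conv_nth lessThan_iff)
  then show "rank (T ! p) q < n" "T ! p ! rank (T ! p) q = q"
    using pref_table_rank_nth[OF assms(1,2)] by auto
qed

lemma pref_table_rank_eq_iff:
  "pref_table n T \<Longrightarrow> p < n \<Longrightarrow> a < n \<Longrightarrow> b < n \<Longrightarrow> rank (T ! p) a = rank (T ! p) b \<longleftrightarrow> a = b"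
  using pref_table_rank(2) by metis

lemma prefers_iff_rank_less:
  assumes "pref_table n T" "p < n" "a < n" "b < n"
  shows "prefers T p a b \<longleftrightarrow> rank (T ! p) a < rank (T ! p) b"
proof
  assume "prefers T p a b"
  then obtain i j where "i < j" "j < n" "T ! p ! i = a" "T ! p ! j = b"
    using pref_table_row(1)[OF assms(1,2)] by (auto simp: prefers_def)
  then show "rank (T ! p) a < rank (T ! p) b"
    using pref_table_rank_nth[OF assms(1,2)] by (metis less_trans)
next
  assume "rank (T ! p) a < rank (T ! p) b"
  then show "prefers T p a b"
    using pref_table_rank[OF assms(1,2)] assms(3,4) pref_table_row(1)[OF assms(1,2)]
    unfolding prefers_def by metis
qed

text \<open>\<open>proposes t m r\<close>: by round \<open>t\<close>, man \<open>m\<close> has been rejected by his first \<open>r\<close> choices.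
  \<open>holds t w s\<close>: by round \<open>t\<close>, woman \<open>w\<close> has had a proposal from one of her first \<open>s\<close> choices.
  A pair meeting with values \<open>p\<close> and \<open>h\<close> passes \<open>p \<and> h\<close> on to the man's next choice and
  \<open>p \<or> h\<close> to the woman's next choice, as a comparator does.\<close>

fun proposes :: "nat list list \<Rightarrow> nat list list \<Rightarrow> nat \<Rightarrow> nat \<Rightarrow> nat \<Rightarrow> bool"
  and holds :: "nat list list \<Rightarrow> nat list list \<Rightarrow> nat \<Rightarrow> nat \<Rightarrow> nat \<Rightarrow> bool" where
  "proposes M W 0 m r \<longleftrightarrow> r = 0"
| "proposes M W (Suc t) m r \<longleftrightarrow> r = 0 \<or> proposes M W t m (r - 1) \<and>
     holds M W t (M ! m ! (r - 1)) (rank (W ! (M ! m ! (r - 1))) m)"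
| "holds M W 0 w s \<longleftrightarrow> False"
| "holds M W (Suc t) w s \<longleftrightarrow> s \<noteq> 0 \<and> (holds M W t w (s - 1) \<or>
     proposes M W t (W ! w ! (s - 1)) (rank (M ! (W ! w ! (s - 1))) w))"

text \<open>The number of Booleans in the state, \<open>n * n\<close> for each sex: an increasing
  sequence of states that stays constant once it repeats is constant from here on.\<close>

definition rounds :: "nat \<Rightarrow> nat" where
  "rounds n = 2 * n * n"

text \<open>The initial state is the least one, and a round combines entries by conjunction and
  disjunction only, hence is monotone.\<close>

lemma proposes_holds_mono_Suc:
  "(proposes M W t m r \<longrightarrow> proposes M W (Suc t) m r) \<and> (holds M W t w s \<longrightarrow> holds M W (Suc t) w s)"
proof (induction t arbitrary: m r w s)
  case (Suc t)
  show ?case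
    unfolding proposes.simps(2)[of M W "Suc t"] holds.simps(2)[of M W "Suc t"]
      proposes.simps(2)[of M W t m r] holds.simps(2)[of M W t w s]
    using Suc by blast
qed auto

section \<open>The rounds reach a fixed point\<close>

locale stable_marriage =
  fixes n :: nat and M W :: "nat list list"
  assumes M: "pref_table n M" and W: "pref_table n W"
begin

abbreviation "mrank m \<equiv> rank (M ! m)"
abbreviation "wrank w \<equiv> rank (W ! w)"

text \<open>For valid tables a round reads only persons and positions below \<open>n\<close>, so
  agreement of two successive states on this finite range propagates to the next round.\<close>

lemma proposes_holds_stationary:
  assumes "\<And>m r. m < n \<Longrightarrow> r < n \<Longrightarrow> proposes M W (Suc t) m r = proposes M W t m r"
    "\<And>w s. w < n \<Longrightarrow> s < n \<Longrightarrow> holds M W (Suc t) w s = holds M W t w s"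
  shows "m < n \<Longrightarrow> r < n \<Longrightarrow> proposes M W (Suc (Suc t)) m r = proposes M W (Suc t) m r"
    "w < n \<Longrightarrow> s < n \<Longrightarrow> holds M W (Suc (Suc t)) w s = holds M W (Suc t) w s"
proof -
  assume m: "m < n" "r < n"
  let ?w = "M ! m ! (r - 1)"
  have w: "?w < n" using m by (intro pref_table_nth_less[OF M]) auto
  show "proposes M W (Suc (Suc t)) m r = proposes M W (Suc t) m r"
    unfolding proposes.simps(2)[of M W "Suc t"] proposes.simps(2)[of M W t m r]
    using assms(1)[of m "r - 1"] assms(2)[OF w, of "wrank ?w m"] pref_table_rank(1)[OF W w, of m] m
    by auto
next
  assume w: "w < n" "s < n"
  let ?m = "W ! w ! (s - 1)"
  have m: "?m < n" using w by (intro pref_table_nth_less[OF W]) auto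
  show "holds M W (Suc (Suc t)) w s = holds M W (Suc t) w s"
    unfolding holds.simps(2)[of M W "Suc t"] holds.simps(2)[of M W t w s]
    using assms(2)[of w "s - 1"] assms(1)[OF m, of "mrank ?m w"] pref_table_rank(1)[OF M m, of w] w
    by auto
qed

text \<open>The entries below \<open>n\<close> that are true, collected in a set, to which the
  theorem on increasing sequences of subsets of a finite set applies. The Boolean distinguishes
  \<open>proposes\<close> from \<open>holds\<close>.\<close>

definition state :: "nat \<Rightarrow> (bool \<times> nat \<times> nat) set" where
  "state t = {(b, p, r). p < n \<and> r < n \<and> (if b then proposes M W t p r else holds M W t p r)}"

lemma state_mono: "mono state"
  unfolding mono_iff_le_Suc
proof
  fix t
  show "state t \<le> state (Suc t)"
    using proposes_holds_mono_Suc[of M W t] unfolding state_def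
    by (auto simp del: proposes.simps holds.simps split: if_splits)
qed

lemma state_subset: "state t \<subseteq> UNIV \<times> {..<n} \<times> {..<n}"
  by (auto simp: state_def)

lemma state_eq_iff:
  "state t = state t' \<longleftrightarrow> (\<forall>p<n. \<forall>r<n. proposes M W t p r = proposes M W t' p r) \<and>
     (\<forall>p<n. \<forall>r<n. holds M W t p r = holds M W t' p r)"
  unfolding state_def set_eq_iff split_paired_All all_bool_eq mem_Collect_eq prod.case if_True if_False
  by blast

lemma state_rounds: "state (Suc (rounds n)) = state (rounds n)"
proof -
  have "finite (range state)"
    by (rule finite_subset[of _ "Pow (UNIV \<times> {..<n} \<times> {..<n})"]) (use state_subset in auto)
  moreover have "\<forall>t. state t = state (Suc t) \<longrightarrow> state (Suc t) = state (Suc (Suc t))"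
  proof (intro allI impI)
    fix t assume "state t = state (Suc t)"
    then have eq: "proposes M W (Suc t) p r = proposes M W t p r"
      "holds M W (Suc t) p r = holds M W t p r" if "p < n" "r < n" for p r
      using that unfolding state_eq_iff by blast+
    show "state (Suc t) = state (Suc (Suc t))"
      unfolding state_eq_iff
      using proposes_holds_stationary[of t, OF eq]
      by (simp del: proposes.simps holds.simps)
  qed
  ultimately have "\<exists>N. (\<forall>i\<le>N. \<forall>j\<le>N. j < i \<longrightarrow> state j \<subset> state i) \<and> (\<forall>i\<ge>N. state N = state i)"
    by (intro finite_mono_remains_stable_implies_strict_prefix state_mono)
  \<comment> \<open>This cardinality is \<open>rounds n\<close>: two kinds of entries,
    \<open>n\<close> persons, \<open>n\<close> positions.\<close>
  then have "state (card ((UNIV :: bool set) \<times> {..<n} \<times> {..<n})) = (\<Union>t. state t)"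
    by (intro finite_mono_strict_prefix_implies_finite_fixpoint state_subset) auto
  then have "state (rounds n) = (\<Union>t. state t)"
    by (simp add: card_cartesian_product rounds_def mult.assoc)
  then have "state (Suc (rounds n)) \<subseteq> state (rounds n)" by auto
  then show ?thesis using monoD[OF state_mono, of "rounds n" "Suc (rounds n)"] by simp
qed

text \<open>With \<open>outbid\<close>, the final state indexed by pairs of persons instead of list
  positions. From \<open>proposed_iff\<close> and \<open>outbid_iff\<close> on, the rounds are no
  longer mentioned until man-optimality.\<close>

definition proposed :: "nat \<Rightarrow> nat \<Rightarrow> bool" where
  "proposed m w \<longleftrightarrow> proposes M W (rounds n) m (mrank m w)"

definition outbid :: "nat \<Rightarrow> nat \<Rightarrow> bool" where
  "outbid m w \<longleftrightarrow> holds M W (rounds n) w (wrank w m)"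

text \<open>At the fixed point, the recursion for the next round becomes an equation between the
  final values.\<close>

lemma proposes_Suc_rank:
  assumes "m < n" "Suc r < n"
  shows "proposes M W (rounds n) m (Suc r) \<longleftrightarrow> proposed m (M ! m ! r) \<and> outbid m (M ! m ! r)"
proof -
  have "proposes M W (rounds n) m (Suc r) = proposes M W (Suc (rounds n)) m (Suc r)"
    using state_rounds assms unfolding state_eq_iff by blast
  then show ?thesis using assms by (simp add: proposed_def outbid_def pref_table_rank_nth[OF M])
qed

lemma holds_Suc_rank:
  assumes "w < n" "Suc s < n"
  shows "holds M W (rounds n) w (Suc s) \<longleftrightarrow> proposed (W ! w ! s) w \<or> outbid (W ! w ! s) w"
proof -
  have "holds M W (rounds n) w (Suc s) = holds M W (Suc (rounds n)) w (Suc s)"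
    using state_rounds assms unfolding state_eq_iff by blast
  then show ?thesis using assms by (auto simp add: proposed_def outbid_def pref_table_rank_nth[OF W])
qed

text \<open>Following the recursion along the man's list collects one factor \<open>outbid\<close>
  for each better choice. Dually, \<open>outbid_iff\<close> collects a disjunction along the woman's
  list.\<close>

lemma proposed_iff:
  assumes "m < n" "w < n"
  shows "proposed m w \<longleftrightarrow> (\<forall>w'<n. mrank m w' < mrank m w \<longrightarrow> outbid m w')"
proof -
  have "proposes M W (rounds n) m r \<longleftrightarrow> (\<forall>w'<n. mrank m w' < r \<longrightarrow> outbid m w')" if "r < n" for r
    using that
  proof (induction r)
    case 0
    show ?case by (cases "rounds n") auto
  next
    case (Suc r)
    then have r: "r < n" by simp
    have "proposes M W (rounds n) m (Suc r) \<longleftrightarrow>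
        (\<forall>w'<n. mrank m w' < r \<longrightarrow> outbid m w') \<and> outbid m (M ! m ! r)"
      using proposes_Suc_rank[OF assms(1) Suc.prems] Suc.IH[OF r]
      by (simp add: proposed_def pref_table_rank_nth[OF M assms(1) r])
    also have "\<dots> \<longleftrightarrow> (\<forall>w'<n. mrank m w' < Suc r \<longrightarrow> outbid m w')"
      using pref_table_nth_less[OF M assms(1) r] pref_table_rank_nth[OF M assms(1) r]
        pref_table_rank(2)[OF M assms(1)]
      by (metis less_Suc_eq)
    finally show ?case .
  qed
  then show ?thesis using pref_table_rank(1)[OF M assms] by (simp add: proposed_def)
qed

lemma outbid_iff:
  assumes "m < n" "w < n"
  shows "outbid m w \<longleftrightarrow> (\<exists>m'<n. wrank w m' < wrank w m \<and> proposed m' w)"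
proof -
  have "holds M W (rounds n) w s \<longleftrightarrow> (\<exists>m'<n. wrank w m' < s \<and> proposed m' w)" if "s < n" for s
    using that
  proof (induction s)
    case 0
    show ?case by (cases "rounds n") auto
  next
    case (Suc s)
    then have s: "s < n" by simp
    have "holds M W (rounds n) w (Suc s) \<longleftrightarrow>
        (\<exists>m'<n. wrank w m' < s \<and> proposed m' w) \<or> proposed (W ! w ! s) w"
      using holds_Suc_rank[OF assms(2) Suc.prems] Suc.IH[OF s]
      by (auto simp add: outbid_def pref_table_rank_nth[OF W assms(2) s])
    also have "\<dots> \<longleftrightarrow> (\<exists>m'<n. wrank w m' < Suc s \<and> proposed m' w)"
      using pref_table_nth_less[OF W assms(2) s] pref_table_rank_nth[OF W assms(2) s]
        pref_table_rank(2)[OF W assms(2)]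
      by (metis less_Suc_eq)
    finally show ?case .
  qed
  then show ?thesis using pref_table_rank(1)[OF W assms(2,1)] by (simp add: outbid_def)
qed

section \<open>The engagements form the man-optimal stable marriage\<close>

definition engaged :: "(nat \<times> nat) set" where
  "engaged = {(m, w). m < n \<and> w < n \<and> proposed m w \<and> \<not> outbid m w}"

text \<open>A proposal to the lower ranked of two women presupposes being outbid at the higher
  ranked one, so he is not engaged to the latter.\<close>

lemma engaged_unique_woman:
  assumes "(m, w) \<in> engaged" "(m, w') \<in> engaged" shows "w = w'"
proof -
  have "\<not> mrank m w < mrank m w'" "\<not> mrank m w' < mrank m w"
    using assms proposed_iff by (auto simp: engaged_def)
  then have "mrank m w = mrank m w'" by simp
  then show ?thesis using assms pref_table_rank_eq_iff[OF M] by (simp add: engaged_def)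
qed

lemma engaged_unique_man:
  assumes "(m, w) \<in> engaged" "(m', w) \<in> engaged" shows "m = m'"
proof -
  have "\<not> wrank w m < wrank w m'" "\<not> wrank w m' < wrank w m"
    using assms outbid_iff by (auto simp: engaged_def)
  then have "wrank w m = wrank w m'" by simp
  then show ?thesis using assms pref_table_rank_eq_iff[OF W] by (simp add: engaged_def)
qed

text \<open>The best man who proposed to \<open>w\<close> is engaged to her.\<close>

lemma proposed_imp_engaged:
  assumes "m < n" "w < n" "proposed m w" shows "\<exists>m'. (m', w) \<in> engaged"
proof -
  obtain m' where m': "m' < n \<and> proposed m' w"
    "\<And>m''. m'' < n \<and> proposed m'' w \<Longrightarrow> wrank w m' \<le> wrank w m''"
    using ex_has_least_nat[of "\<lambda>m. m < n \<and> proposed m w" m "wrank w"] assms by blast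
  then have "\<not> outbid m' w" using outbid_iff[of m' w] assms(2) by fastforce
  then show ?thesis using m' assms(2) by (auto simp: engaged_def)
qed

text \<open>A man without partner is outbid wherever he proposes, hence proposes to every woman.
  Then every woman has a partner, and these are \<open>n\<close> different men among the other
  \<open>n - 1\<close>.\<close>

lemma engaged_man:
  assumes m: "m < n" shows "\<exists>w. (m, w) \<in> engaged"
proof (rule ccontr)
  assume single: "\<nexists>w. (m, w) \<in> engaged"
  have proposed: "proposed m w" if "w < n" for w
    using that
  proof (induction "mrank m w" arbitrary: w rule: less_induct)
    case less
    have "outbid m w'" if "w' < n" "mrank m w' < mrank m w" for w'
      using less.hyps[OF that(2,1)] single m that(1) by (auto simp: engaged_def)
    then show ?case using proposed_iff[OF m less.prems] by blast
  qed
  have "\<forall>w\<in>{..<n}. \<exists>m'. (m', w) \<in> engaged"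
    using proposed_imp_engaged[OF m] proposed by blast
  then obtain h where h: "\<And>w. w < n \<Longrightarrow> (h w, w) \<in> engaged"
    by (metis lessThan_iff)
  have "inj_on h {..<n}"
    using h engaged_unique_woman by (metis inj_onI lessThan_iff)
  moreover have "h ` {..<n} \<subseteq> {..<n} - {m}"
  proof
    fix y assume "y \<in> h ` {..<n}"
    then obtain w where "w < n" "y = h w" by auto
    then show "y \<in> {..<n} - {m}" using h[of w] single by (auto simp: engaged_def)
  qed
  ultimately have "card {..<n} \<le> card ({..<n} - {m})"
    by (intro card_inj_on_le) auto
  then show False using m by simp
qed

lemma engaged_woman:
  assumes w: "w < n" shows "\<exists>m. (m, w) \<in> engaged"
proof -
  obtain h where h: "\<And>m. m < n \<Longrightarrow> (m, h m) \<in> engaged"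
    using engaged_man by metis
  have "inj_on h {..<n}"
    using h engaged_unique_man by (metis inj_onI lessThan_iff)
  moreover have "h ` {..<n} \<subseteq> {..<n}"
    using h by (auto simp: engaged_def)
  ultimately have "h ` {..<n} = {..<n}"
    by (intro endo_inj_surj) auto
  then obtain m where "m < n" "w = h m" using w by (metis imageE lessThan_iff)
  then show ?thesis using h by blast
qed

lemma marriage_engaged: "marriage n engaged"
  unfolding marriage_def
proof (intro conjI allI impI)
  show "engaged \<subseteq> {..<n} \<times> {..<n}" by (auto simp: engaged_def)
  show "\<exists>!w. (m, w) \<in> engaged" if "m < n" for m
    using engaged_man[OF that] engaged_unique_woman by blast
  show "\<exists>!m. (m, w) \<in> engaged" if "w < n" for w
    using engaged_woman[OF that] engaged_unique_man by blast
qed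

text \<open>A man proposes down his list, so he has also proposed to any \<open>w\<close> whom he
  likes better than his partner. If \<open>w\<close> prefers him to her partner, this proposal
  outbids the partner.\<close>

lemma stable_engaged: "stable n M W engaged"
  unfolding stable_def
proof (intro conjI marriage_engaged notI)
  assume "\<exists>m w m' w'. (m, w') \<in> engaged \<and> (m', w) \<in> engaged \<and> prefers M m w w' \<and> prefers W w m m'"
  then obtain m w m' w' where *: "(m, w') \<in> engaged" "(m', w) \<in> engaged" "prefers M m w w'"
    "prefers W w m m'" by blast
  then have lt: "m < n" "w < n" "m' < n" "w' < n" by (auto simp: engaged_def)
  then have less: "mrank m w < mrank m w'" "wrank w m < wrank w m'"
    using * prefers_iff_rank_less[OF M] prefers_iff_rank_less[OF W] by auto
  have "proposed m w"
    using *(1) less(1) lt proposed_iff[of m w] proposed_iff[of m w'] by (auto simp: engaged_def)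
  then have "outbid m' w" using outbid_iff[of m' w] less(2) lt by blast
  then show False using *(2) by (simp add: engaged_def)
qed

text \<open>No man gets past his partner in a stable \<open>Q\<close>. The second half is what makes
  the induction work: a held proposal always has a witness among the woman's first \<open>s\<close>
  choices who likes her at least as well as his partner in \<open>Q\<close>.\<close>

lemma stable_partner_bound:
  assumes Q: "stable n M W Q"
  shows "(\<forall>m w r. (m, w) \<in> Q \<longrightarrow> r < n \<longrightarrow> proposes M W t m r \<longrightarrow> r \<le> mrank m w) \<and>
    (\<forall>w s. w < n \<longrightarrow> s < n \<longrightarrow> holds M W t w s \<longrightarrow>
      (\<exists>s'<s. \<forall>w'. (W ! w ! s', w') \<in> Q \<longrightarrow> mrank (W ! w ! s') w \<le> mrank (W ! w ! s') w'))"
proof (induction t)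
  case (Suc t)
  have lt: "m < n" "w < n" if "(m, w) \<in> Q" for m w
    using Q that by (auto simp: stable_def marriage_def)
  have man: "\<exists>w. (m, w) \<in> Q" if "m < n" for m
    using Q that by (auto simp: stable_def marriage_def)
  have unique: "m = m'" if "(m, w) \<in> Q" "(m', w) \<in> Q" for m m' w
    using Q that lt[OF that(1)] unfolding stable_def marriage_def by blast
  have man_step: "Suc r \<le> mrank m w" if *: "(m, w) \<in> Q" "Suc r < n" "proposes M W t m r"
    "holds M W t (M ! m ! r) (wrank (M ! m ! r) m)" for m w r
  proof (rule ccontr)
    \<comment> \<open>Otherwise \<open>w\<close>, who turns him down in this round, is his partner
      in \<open>Q\<close>. The witness for her held proposal then forms a blocking pair with her:
      she ranks him before \<open>m\<close>, and he has another partner in \<open>Q\<close>, to whom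
      he prefers her.\<close>
    assume "\<not> Suc r \<le> mrank m w"
    moreover have "r \<le> mrank m w" using Suc.IH * by simp
    ultimately have "mrank m w = r" by simp
    then have w: "M ! m ! r = w" using pref_table_rank(2)[OF M lt[OF *(1)]] by simp
    have s: "wrank w m < n" using pref_table_rank(1)[OF W] lt[OF *(1)] by blast
    then obtain s' where s': "s' < wrank w m"
      "\<And>w'. (W ! w ! s', w') \<in> Q \<Longrightarrow> mrank (W ! w ! s') w \<le> mrank (W ! w ! s') w'"
      using Suc.IH lt(2)[OF *(1)] *(4) unfolding w by blast
    define m' where "m' = W ! w ! s'"
    have m': "m' < n" unfolding m'_def using lt[OF *(1)] s s' by (intro pref_table_nth_less[OF W]) auto
    then obtain w' where w': "(m', w') \<in> Q" using man by blast
    have rank: "wrank w m' = s'" unfolding m'_def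
      using lt[OF *(1)] s s' by (intro pref_table_rank_nth[OF W]) auto
    have "m' \<noteq> m" using rank s' by auto
    then have "w \<noteq> w'" using unique *(1) w' by blast
    then have "mrank m' w \<noteq> mrank m' w'"
      using pref_table_rank(2)[OF M m'] lt[OF *(1)] lt[OF w'] by metis
    then have "prefers M m' w w'"
      using s'(2) w' lt[OF w'] lt[OF *(1)] prefers_iff_rank_less[OF M m', of w w']
      unfolding m'_def by fastforce
    moreover have "prefers W w m' m"
      using prefers_iff_rank_less[OF W _ m', of w m] rank s' lt[OF *(1)] by simp
    ultimately show False using Q *(1) w' unfolding stable_def by blast
  qed
  have woman_step: "\<exists>s'<Suc s. \<forall>w'. (W ! w ! s', w') \<in> Q \<longrightarrow> mrank (W ! w ! s') w \<le> mrank (W ! w ! s') w'"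
    if *: "w < n" "Suc s < n"
      "holds M W t w s \<or> proposes M W t (W ! w ! s) (mrank (W ! w ! s) w)" for w s
    using *(3)
  proof
    assume "holds M W t w s"
    then show ?thesis using Suc.IH * by (meson Suc_lessD less_SucI)
  next
    \<comment> \<open>The proposer is himself the witness: by the bound for men he has not got past
      his partner in \<open>Q\<close>.\<close>
    assume p: "proposes M W t (W ! w ! s) (mrank (W ! w ! s) w)"
    have "W ! w ! s < n" using pref_table_nth_less[OF W] * by simp
    then have "mrank (W ! w ! s) w < n" using pref_table_rank(1)[OF M] * by blast
    then show ?thesis using Suc.IH p by blast
  qed
  show ?case
  proof (intro conjI allI impI)
    fix m w r assume "(m, w) \<in> Q" "r < n" "proposes M W (Suc t) m r"
    then show "r \<le> mrank m w" using man_step by (cases r) simp_all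
  next
    fix w s assume "w < n" "s < n" "holds M W (Suc t) w s"
    then show "\<exists>s'<s. \<forall>w'. (W ! w ! s', w') \<in> Q \<longrightarrow> mrank (W ! w ! s') w \<le> mrank (W ! w ! s') w'"
      using woman_step by (cases s) simp_all
  qed
qed auto

lemma man_optimal_engaged: "man_optimal n M W engaged"
  unfolding man_optimal_def
proof (intro conjI stable_engaged allI impI)
  fix Q m w w' assume Q: "stable n M W Q" and *: "(m, w) \<in> engaged \<and> (m, w') \<in> Q"
  have lt: "m < n" "w < n" "w' < n" using Q * by (auto simp: stable_def marriage_def engaged_def)
  have "mrank m w \<le> mrank m w'"
    using stable_partner_bound[OF Q, of "rounds n"] * pref_table_rank(1)[OF M lt(1,2)]
    by (auto simp: engaged_def proposed_def)
  moreover have "w = w'" if "mrank m w = mrank m w'"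
    using that pref_table_rank(2)[OF M lt(1)] lt by metis
  ultimately show "w = w' \<or> prefers M m w w'"
    using prefers_iff_rank_less[OF M lt] by fastforce
qed

text \<open>Of two man-optimal marriages each is at least as good as the other for every man, so
  they agree, and the existential refers to \<open>engaged\<close>.\<close>

lemma man_optimal_pair_iff:
  assumes "m < n" "w < n"
  shows "(\<exists>P. man_optimal n M W P \<and> (m, w) \<in> P) \<longleftrightarrow>
    proposes M W (rounds n) m (mrank m w) \<and> \<not> holds M W (rounds n) w (wrank w m)"
proof -
  have "(m, w) \<in> engaged" if P: "man_optimal n M W P" "(m, w) \<in> P" for P
  proof -
    obtain w' where w': "(m, w') \<in> engaged" using engaged_man[OF assms(1)] by blast
    then have "w' < n" by (simp add: engaged_def)
    moreover have "w = w' \<or> prefers M m w w'" "w' = w \<or> prefers M m w' w"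
      using P w' man_optimal_engaged unfolding man_optimal_def by blast+
    ultimately have "w = w'" using prefers_iff_rank_less[OF M] assms
      by (metis less_asym)
    then show ?thesis using w' by simp
  qed
  then have "(\<exists>P. man_optimal n M W P \<and> (m, w) \<in> P) \<longleftrightarrow> (m, w) \<in> engaged"
    using man_optimal_engaged by blast
  then show ?thesis using assms by (simp add: engaged_def proposed_def outbid_def)
qed

end

section \<open>The comparator network\<close>

lemma digits_eq_iff:
  fixes k :: nat
  assumes "b < k" "b' < k" shows "a * k + b = a' * k + b' \<longleftrightarrow> a = a' \<and> b = b'"
proof
  assume eq: "a * k + b = a' * k + b'"
  then have "(a * k + b) div k = (a' * k + b') div k" by simp
  then have "a = a'" using assms by simp
  then show "a = a' \<and> b = b'" using eq by simp
qed simp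

lemma digits_div_mod:
  fixes k :: nat
  assumes "b < k" shows "(a * k + b) div k = a" "(a * k + b) mod k = b"
  using assms by simp_all

lemma digits_less:
  fixes k :: nat
  assumes "a < c" "b < k" shows "a * k + b < c * k"
proof -
  have "a * k + b < Suc a * k" using assms(2) by simp
  also have "\<dots> \<le> c * k" using assms(1) by (intro mult_right_mono) auto
  finally show ?thesis .
qed

lemma digits_bounds:
  fixes n :: nat
  assumes "x < c * n" shows "x div n < c" "x mod n < n" "x div n * n + x mod n = x"
  using assms by (auto simp: less_mult_imp_div_less intro!: mod_less_divisor gr0I)

section \<open>Layers of gates on disjoint wires\<close>

lemma length_fold_apply_cgate: "length (fold apply_cgate gs v) = length v"
proof (induction gs arbitrary: v)
  case (Cons g gs)
  have "length (apply_cgate g v) = length v" by (cases g) auto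
  then show ?case using Cons by simp
qed simp

text \<open>No wire is used twice, so every comparator still finds the original values when its turn
  comes, and the sequential \<open>fold\<close> acts as one parallel layer. The index list
  \<open>xs\<close> with maps \<open>f\<close> and \<open>g\<close> to wires fits the phases of the
  network, which are given by gate numbers.\<close>

lemma fold_disjoint_comparators:
  assumes "distinct xs" "inj_on f (set xs)" "inj_on g (set xs)" "f ` set xs \<inter> g ` set xs = {}"
    and "\<And>x. x \<in> set xs \<Longrightarrow> f x < length v \<and> g x < length v"
    and "\<And>x. x \<in> set xs \<Longrightarrow> h x = Comparator (f x) (g x)"
  shows "x \<in> set xs \<Longrightarrow> fold apply_cgate (map h xs) v ! f x \<longleftrightarrow> v ! f x \<and> v ! g x"
    "x \<in> set xs \<Longrightarrow> fold apply_cgate (map h xs) v ! g x \<longleftrightarrow> v ! f x \<or> v ! g x"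
    "y \<notin> f ` set xs \<Longrightarrow> y \<notin> g ` set xs \<Longrightarrow> fold apply_cgate (map h xs) v ! y = v ! y"
proof -
  have "(\<forall>x\<in>set xs. (fold apply_cgate (map h xs) v ! f x \<longleftrightarrow> v ! f x \<and> v ! g x) \<and>
       (fold apply_cgate (map h xs) v ! g x \<longleftrightarrow> v ! f x \<or> v ! g x)) \<and>
     (\<forall>y. y \<notin> f ` set xs \<longrightarrow> y \<notin> g ` set xs \<longrightarrow> fold apply_cgate (map h xs) v ! y = v ! y)"
    using assms
  proof (induction xs arbitrary: v)
    case (Cons z xs)
    define u where "u = v[f z := v ! f z \<and> v ! g z, g z := v ! f z \<or> v ! g z]"
    have z: "f z < length v" "g z < length v" "f z \<noteq> g z"
      and h: "h z = Comparator (f z) (g z)"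
      using Cons.prems(4,5,6) by auto
    have new: "z \<notin> set xs" "f z \<notin> f ` set xs" "g z \<notin> g ` set xs" "f z \<notin> g ` set xs" "g z \<notin> f ` set xs"
      using Cons.prems(1-4) by auto
    have u: "u ! f z \<longleftrightarrow> v ! f z \<and> v ! g z" "u ! g z \<longleftrightarrow> v ! f z \<or> v ! g z"
      "\<And>y. y \<noteq> f z \<Longrightarrow> y \<noteq> g z \<Longrightarrow> u ! y = v ! y"
      using z by (auto simp: u_def nth_list_update)
    have IH: "(\<forall>x\<in>set xs. (fold apply_cgate (map h xs) u ! f x \<longleftrightarrow> u ! f x \<and> u ! g x) \<and>
       (fold apply_cgate (map h xs) u ! g x \<longleftrightarrow> u ! f x \<or> u ! g x)) \<and>
     (\<forall>y. y \<notin> f ` set xs \<longrightarrow> y \<notin> g ` set xs \<longrightarrow> fold apply_cgate (map h xs) u ! y = u ! y)"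
      by (rule Cons.IH) (use Cons.prems in \<open>auto simp: u_def\<close>)
    have old: "u ! f x = v ! f x" "u ! g x = v ! g x" if "x \<in> set xs" for x
    proof -
      have "f x \<noteq> f z" "f x \<noteq> g z" "g x \<noteq> f z" "g x \<noteq> g z"
        using new that by (metis imageI)+
      then show "u ! f x = v ! f x" "u ! g x = v ! g x" by (simp_all add: u(3))
    qed
    have step: "fold apply_cgate (map h (z # xs)) v = fold apply_cgate (map h xs) u"
      by (simp add: h u_def)
    show ?case
      unfolding step using IH old new u by auto
  qed auto
  then show "x \<in> set xs \<Longrightarrow> fold apply_cgate (map h xs) v ! f x \<longleftrightarrow> v ! f x \<and> v ! g x"
    "x \<in> set xs \<Longrightarrow> fold apply_cgate (map h xs) v ! g x \<longleftrightarrow> v ! f x \<or> v ! g x"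
    "y \<notin> f ` set xs \<Longrightarrow> y \<notin> g ` set xs \<Longrightarrow> fold apply_cgate (map h xs) v ! y = v ! y"
    by blast+
qed

lemma fold_negations:
  assumes "distinct xs" "inj_on f (set xs)" "\<And>x. x \<in> set xs \<Longrightarrow> f x < length v"
    and "\<And>x. x \<in> set xs \<Longrightarrow> h x = Negation (f x)"
  shows "x \<in> set xs \<Longrightarrow> fold apply_cgate (map h xs) v ! f x \<longleftrightarrow> \<not> v ! f x"
    "y \<notin> f ` set xs \<Longrightarrow> fold apply_cgate (map h xs) v ! y = v ! y"
proof -
  have "(\<forall>x\<in>set xs. fold apply_cgate (map h xs) v ! f x \<longleftrightarrow> \<not> v ! f x) \<and>
     (\<forall>y. y \<notin> f ` set xs \<longrightarrow> fold apply_cgate (map h xs) v ! y = v ! y)"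
    using assms
  proof (induction xs arbitrary: v)
    case (Cons z xs)
    define u where "u = v[f z := \<not> v ! f z]"
    have z: "f z < length v" and h: "h z = Negation (f z)" using Cons.prems(3,4) by auto
    have new: "z \<notin> set xs" "f z \<notin> f ` set xs" using Cons.prems(1,2) by auto
    have u: "u ! f z \<longleftrightarrow> \<not> v ! f z" "\<And>y. y \<noteq> f z \<Longrightarrow> u ! y = v ! y"
      using z by (auto simp: u_def)
    have IH: "(\<forall>x\<in>set xs. fold apply_cgate (map h xs) u ! f x \<longleftrightarrow> \<not> u ! f x) \<and>
     (\<forall>y. y \<notin> f ` set xs \<longrightarrow> fold apply_cgate (map h xs) u ! y = u ! y)"
      by (rule Cons.IH) (use Cons.prems in \<open>auto simp: u_def\<close>)
    have old: "u ! f x = v ! f x" if "x \<in> set xs" for x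
      using that new by (intro u(2)) (metis imageI)
    have step: "fold apply_cgate (map h (z # xs)) v = fold apply_cgate (map h xs) u"
      by (simp add: h u_def)
    show ?case
      unfolding step using IH old new u by auto
  qed auto
  then show "x \<in> set xs \<Longrightarrow> fold apply_cgate (map h xs) v ! f x \<longleftrightarrow> \<not> v ! f x"
    "y \<notin> f ` set xs \<Longrightarrow> fold apply_cgate (map h xs) v ! y = v ! y"
    by blast+
qed

text \<open>Wires: a chain of wires per person (men are persons \<open>0, \<dots>, n - 1\<close>, women \<open>n, \<dots>, 2n - 1\<close>),
  a cell per person and possible partner, and a result wire per man. At time \<open>t\<close>, position \<open>r\<close>
  of the preference list of person \<open>p\<close> is on wire \<open>chain n p (rounds n - t + r)\<close>, so that
  the shift to the next position in each round needs no gates.\<close>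

definition chain_len :: "nat \<Rightarrow> nat" where
  "chain_len n = rounds n + n"

definition cell_base :: "nat \<Rightarrow> nat" where
  "cell_base n = 2 * n * chain_len n"

definition result_base :: "nat \<Rightarrow> nat" where
  "result_base n = cell_base n + 2 * n * n"

definition num_wires :: "nat \<Rightarrow> nat" where
  "num_wires n = result_base n + n"

definition chain :: "nat \<Rightarrow> nat \<Rightarrow> nat \<Rightarrow> nat" where
  "chain n p u = p * chain_len n + u"

definition cell :: "nat \<Rightarrow> nat \<Rightarrow> nat \<Rightarrow> nat" where
  "cell n p q = cell_base n + p * n + q"

text \<open>The summands are the sizes of the five phases of \<open>network_gate\<close>, in
  order.\<close>

definition num_cgates :: "nat \<Rightarrow> nat" where
  "num_cgates n = rounds n * (n * n) + (2 * n * n + (n * n + (n * n + n)))"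

text \<open>Polymorphic in the result, so that the same case distinction defines the gates and the
  sources of their encoded bits, and the two can be compared phase by phase. Each branch gets the
  index relative to the start of its phase.\<close>

definition by_phase ::
    "nat \<Rightarrow> (nat \<Rightarrow> 'a) \<Rightarrow> (nat \<Rightarrow> 'a) \<Rightarrow> (nat \<Rightarrow> 'a) \<Rightarrow> (nat \<Rightarrow> 'a) \<Rightarrow> (nat \<Rightarrow> 'a) \<Rightarrow> nat \<Rightarrow> 'a" where
  "by_phase n f1 f2 f3 f4 f5 g =
     (if g < rounds n * (n * n) then f1 g
      else if g - rounds n * (n * n) < 2 * n * n then f2 (g - rounds n * (n * n))
      else if g - rounds n * (n * n) - 2 * n * n < n * n then f3 (g - rounds n * (n * n) - 2 * n * n)
      else if g - rounds n * (n * n) - 2 * n * n - n * n < n * n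
        then f4 (g - rounds n * (n * n) - 2 * n * n - n * n)
      else f5 (g - rounds n * (n * n) - 2 * n * n - n * n - n * n))"

lemma map_upt_add: "map f [0..<a + b] = map f [0..<a] @ map (\<lambda>x. f (a + x)) [0..<b]"
  by (rule nth_equalityI) (auto simp: nth_append)

text \<open>The phases are: the rounds; moving the final state to the cells; negating the women's cells;
  conjoining the man's and the woman's cell of each pair; selecting the designated woman.\<close>

definition network_gate :: "nat \<Rightarrow> nat list list \<Rightarrow> nat list list \<Rightarrow> nat \<Rightarrow> nat \<Rightarrow> cgate" where
  "network_gate n M W w0 = by_phase n
    (\<lambda>g. let t = g div (n * n); m = g mod (n * n) div n; w = g mod n in
       Comparator (chain n m (rounds n - t + rank (M ! m) w))
         (chain n (n + w) (rounds n - t + rank (W ! w) m)))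
    (\<lambda>x. Comparator (chain n (x div n) (x mod n)) (cell n (x div n) ((M @ W) ! (x div n) ! (x mod n))))
    (\<lambda>x. Negation (cell_base n + n * n + x))
    (\<lambda>x. Comparator (cell_base n + x) (cell n (n + x mod n) (x div n)))
    (\<lambda>m. Comparator (cell n m w0) (result_base n + m))"

definition network :: "nat \<Rightarrow> nat list list \<Rightarrow> nat list list \<Rightarrow> nat \<Rightarrow> cgate list" where
  "network n M W w0 = map (network_gate n M W w0) [0..<num_cgates n]"

text \<open>The first \<open>n\<close> chains are those of the men. At time 0, offset
  \<open>rounds n\<close> is position 0, where every man proposes; the True wires before it serve as
  position 0 of the later rounds. The women's chains start False, as nobody holds a
  proposal.\<close>

definition initial_wire :: "nat \<Rightarrow> nat \<Rightarrow> bool" where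
  "initial_wire n y \<longleftrightarrow> y < n * chain_len n \<and> y mod chain_len n \<le> rounds n"

definition initial_wires :: "nat \<Rightarrow> bool list" where
  "initial_wires n = map (initial_wire n) [0..<num_wires n]"

lemma chain_eq_iff:
  "u < chain_len n \<Longrightarrow> u' < chain_len n \<Longrightarrow> chain n p u = chain n p' u' \<longleftrightarrow> p = p' \<and> u = u'"
  by (simp add: chain_def digits_eq_iff)

lemma chain_less: "p < 2 * n \<Longrightarrow> u < chain_len n \<Longrightarrow> chain n p u < cell_base n"
  unfolding chain_def cell_base_def by (rule digits_less)

lemma cell_eq_iff: "q < n \<Longrightarrow> q' < n \<Longrightarrow> cell n p q = cell n p' q' \<longleftrightarrow> p = p' \<and> q = q'"
  using digits_eq_iff[of q n q' p p'] by (simp add: cell_def)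

lemma cell_less: "p < 2 * n \<Longrightarrow> q < n \<Longrightarrow> cell n p q < result_base n"
  using digits_less[of p "2 * n" q n] by (simp add: cell_def result_base_def)

lemma cell_ge: "cell_base n \<le> cell n p q"
  by (simp add: cell_def)

lemma wire_bounds: "cell_base n \<le> result_base n" "result_base n \<le> num_wires n"
  by (simp_all add: result_base_def num_wires_def)

section \<open>Semantics of the network\<close>

context stable_marriage
begin

lemma pref_table_nth_append:
  assumes "p < 2 * n"
  shows "r < n \<Longrightarrow> (M @ W) ! p ! r < n"
    "r < n \<Longrightarrow> rank ((M @ W) ! p) ((M @ W) ! p ! r) = r"
    "q < n \<Longrightarrow> rank ((M @ W) ! p) q < n"
    "q < n \<Longrightarrow> (M @ W) ! p ! rank ((M @ W) ! p) q = q"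
proof -
  have len: "length M = n" using M by (simp add: pref_table_def)
  have "p - n < n" if "\<not> p < n" using assms that by simp
  then show "r < n \<Longrightarrow> (M @ W) ! p ! r < n"
    "r < n \<Longrightarrow> rank ((M @ W) ! p) ((M @ W) ! p ! r) = r"
    "q < n \<Longrightarrow> rank ((M @ W) ! p) q < n"
    "q < n \<Longrightarrow> (M @ W) ! p ! rank ((M @ W) ! p) q = q"
    using pref_table_rank[OF M, of p q] pref_table_rank[OF W, of "p - n" q]
      pref_table_rank_nth[OF M, of p r] pref_table_rank_nth[OF W, of "p - n" r]
      pref_table_nth_less[OF M, of p r] pref_table_nth_less[OF W, of "p - n" r]
    by (auto simp: nth_append len)
qed

text \<open>The wires before the current window are a reserve of entries for position 0 of the
  rounds to come. Wires after the window carry discarded outputs, of which nothing is claimed. The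
  False wires from \<open>cell_base n\<close> on are the blank targets of the later phases.\<close>

definition round_invariant :: "nat \<Rightarrow> bool list \<Rightarrow> bool" where
  "round_invariant t v \<longleftrightarrow> length v = num_wires n \<and>
     (\<forall>m<n. (\<forall>u<rounds n - t. v ! chain n m u) \<and>
       (\<forall>r<n. v ! chain n m (rounds n - t + r) = proposes M W t m r)) \<and>
     (\<forall>w<n. (\<forall>u<rounds n - t. \<not> v ! chain n (n + w) u) \<and>
       (\<forall>s<n. v ! chain n (n + w) (rounds n - t + s) = holds M W t w s)) \<and>
     (\<forall>y<num_wires n. cell_base n \<le> y \<longrightarrow> \<not> v ! y)"

lemma round_invariant_initial: "round_invariant 0 (initial_wires n)"
proof -
  have init: "initial_wires n ! chain n p u \<longleftrightarrow> p < n \<and> u \<le> rounds n"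
    if "p < 2 * n" "u < chain_len n" for p u
  proof -
    have "chain n p u < num_wires n" using chain_less[OF that] wire_bounds[of n] by simp
    moreover have "p < n \<longleftrightarrow> chain n p u < n * chain_len n"
    proof
      show "p < n \<Longrightarrow> chain n p u < n * chain_len n"
        unfolding chain_def using that(2) by (intro digits_less)
      assume "chain n p u < n * chain_len n"
      then have "p * chain_len n < n * chain_len n" unfolding chain_def by (rule add_lessD1)
      then show "p < n" by simp
    qed
    moreover have "chain n p u mod chain_len n = u" using that(2) by (simp add: chain_def)
    ultimately show ?thesis by (simp add: initial_wires_def initial_wire_def)
  qed
  have "\<not> initial_wires n ! y" if "y < num_wires n" "cell_base n \<le> y" for y
  proof -
    have "n * chain_len n \<le> cell_base n" by (simp add: cell_base_def)
    then show ?thesis using that by (auto simp: initial_wires_def initial_wire_def)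
  qed
  then show ?thesis
    unfolding round_invariant_def by (auto simp: init chain_len_def) (simp add: initial_wires_def)
qed

text \<open>A person and a rank determine the partner, so the comparators of one round use pairwise
  different wires and act in parallel.\<close>

lemma round_invariant_step:
  assumes t: "t < rounds n" and v: "round_invariant t v"
  shows "round_invariant (Suc t)
    (fold apply_cgate (map (\<lambda>x. network_gate n M W w0 (t * (n * n) + x)) [0..<n * n]) v)"
    (is "round_invariant _ ?v")
proof -
  define d where "d = rounds n - t"
  define f where "f x = chain n (x div n) (d + mrank (x div n) (x mod n))" for x
  define g where "g x = chain n (n + x mod n) (d + wrank (x mod n) (x div n))" for x
  let ?X = "{0..<n * n}"
  have pos: "d + r < chain_len n" if "r < n" for r
    using that by (simp add: chain_len_def d_def)
  have x: "x div n < n" "x mod n < n" "mrank (x div n) (x mod n) < n" "wrank (x mod n) (x div n) < n"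
    if "x \<in> ?X" for x
    using digits_bounds[of x n n] that pref_table_rank(1)[OF M] pref_table_rank(1)[OF W] by auto
  have xI: "x = y" if "x div n = y div n" "x mod n = y mod n" for x y
    using that by (metis div_mult_mod_eq)
  have inj_f: "inj_on f ?X"
  proof (rule inj_onI)
    fix y z assume *: "y \<in> ?X" "z \<in> ?X" "f y = f z"
    then have "y div n = z div n" "mrank (y div n) (y mod n) = mrank (z div n) (z mod n)"
      using x[OF *(1)] x[OF *(2)] by (auto simp: f_def chain_eq_iff pos)
    then show "y = z" using x[OF *(1)] x[OF *(2)] by (auto simp: pref_table_rank_eq_iff[OF M] intro: xI)
  qed
  have inj_g: "inj_on g ?X"
  proof (rule inj_onI)
    fix y z assume *: "y \<in> ?X" "z \<in> ?X" "g y = g z"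
    then have "y mod n = z mod n" "wrank (y mod n) (y div n) = wrank (z mod n) (z div n)"
      using x[OF *(1)] x[OF *(2)] by (auto simp: g_def chain_eq_iff pos)
    then show "y = z" using x[OF *(1)] x[OF *(2)] by (auto simp: pref_table_rank_eq_iff[OF W] intro: xI)
  qed
  have disj: "f ` ?X \<inter> g ` ?X = {}"
  proof -
    have "f y \<noteq> g z" if "y \<in> ?X" "z \<in> ?X" for y z
      using x[OF that(1)] x[OF that(2)] by (simp add: f_def g_def chain_eq_iff pos)
    then show ?thesis by blast
  qed
  have fg_less: "f x < cell_base n \<and> g x < cell_base n" if "x \<in> ?X" for x
    using x[OF that] by (simp add: f_def g_def chain_less pos)
  have len: "length v = num_wires n" using v by (simp add: round_invariant_def)
  have gate: "network_gate n M W w0 (t * (n * n) + x) = Comparator (f x) (g x)" if "x \<in> ?X" for x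
  proof -
    have "t * (n * n) + x < rounds n * (n * n)" using t that by (intro digits_less) auto
    moreover have "(t * (n * n) + x) div (n * n) = t" "(t * (n * n) + x) mod (n * n) = x"
      using that by (intro digits_div_mod; simp)+
    moreover have "(t * (n * n) + x) mod n = x mod n" by (simp flip: mult.assoc)
    ultimately show ?thesis by (simp add: network_gate_def by_phase_def f_def g_def Let_def d_def)
  qed
  note fold = fold_disjoint_comparators[of "[0..<n * n]" f g v
      "\<lambda>x. network_gate n M W w0 (t * (n * n) + x)", simplified, OF inj_f inj_g disj]
  have fg_len: "f x < length v \<and> g x < length v" if "x \<in> ?X" for x
    using fg_less[OF that] len wire_bounds[of n] by simp
  have touched: "?v ! f x \<longleftrightarrow> v ! f x \<and> v ! g x" "?v ! g x \<longleftrightarrow> v ! f x \<or> v ! g x"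
    if "x \<in> ?X" for x
    using fold(1,2)[of x] fg_len gate that by auto
  have untouched: "?v ! y = v ! y" if "y \<notin> f ` ?X" "y \<notin> g ` ?X" for y
    using fold(3)[of y] fg_len gate that by auto
  have early: "?v ! chain n p u = v ! chain n p u" if "u < d" for p u
  proof (rule untouched)
    have u: "u < chain_len n" using that by (simp add: chain_len_def d_def)
    have "chain n p u \<noteq> f x" "chain n p u \<noteq> g x" if "x \<in> ?X" for x
      using x[OF that] \<open>u < d\<close> by (simp_all add: f_def g_def chain_eq_iff pos u)
    then show "chain n p u \<notin> f ` ?X" "chain n p u \<notin> g ` ?X" by blast+
  qed
  have pair: "m * n + w \<in> ?X" "(m * n + w) div n = m" "(m * n + w) mod n = w" if "m < n" "w < n" for m w
    using that digits_less[of m n w n] by auto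
  have fg_pair: "f (m * n + w) = chain n m (d + mrank m w)"
    "g (m * n + w) = chain n (n + w) (d + wrank w m)" if "m < n" "w < n" for m w
    unfolding f_def g_def pair(2,3)[OF that] by (rule refl)+
  \<comment> \<open>The next window starts one wire earlier: what was computed at position
    \<open>r\<close> becomes position \<open>r + 1\<close>, and the untouched wire before the old
    window becomes position 0.\<close>
  have next_pos: "d = Suc (rounds n - Suc t)" using t by (simp add: d_def)
  have vs: "\<And>m u. m < n \<Longrightarrow> u < d \<Longrightarrow> v ! chain n m u"
    "\<And>m r. m < n \<Longrightarrow> r < n \<Longrightarrow> v ! chain n m (d + r) = proposes M W t m r"
    "\<And>w u. w < n \<Longrightarrow> u < d \<Longrightarrow> \<not> v ! chain n (n + w) u"
    "\<And>w s. w < n \<Longrightarrow> s < n \<Longrightarrow> v ! chain n (n + w) (d + s) = holds M W t w s"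
    "\<And>y. y < num_wires n \<Longrightarrow> cell_base n \<le> y \<Longrightarrow> \<not> v ! y"
    using v unfolding round_invariant_def d_def by blast+
  show ?thesis
    unfolding round_invariant_def
  proof (intro conjI allI impI)
    show "length ?v = num_wires n" by (simp add: length_fold_apply_cgate len)
  next
    fix m u assume "m < n" "u < rounds n - Suc t"
    then show "?v ! chain n m u" using vs(1) early next_pos by simp
  next
    fix m r assume m: "m < n" "r < n"
    show "?v ! chain n m (rounds n - Suc t + r) = proposes M W (Suc t) m r"
    proof (cases r)
      case 0
      then show ?thesis using vs(1)[OF m(1)] early next_pos by simp
    next
      case (Suc r')
      let ?w = "M ! m ! r'"
      have r': "r' < n" using Suc m by simp
      have w: "?w < n" using pref_table_nth_less[OF M m(1) r'] .
      have "chain n m (rounds n - Suc t + r) = f (m * n + ?w)"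
        using Suc next_pos by (simp add: fg_pair[OF m(1) w] pref_table_rank_nth[OF M m(1) r'])
      then show ?thesis
        using touched(1)[OF pair(1)[OF m(1) w]] vs(2)[OF m(1) r'] Suc
          vs(4)[OF w pref_table_rank(1)[OF W w m(1)]]
        by (simp add: fg_pair[OF m(1) w] pref_table_rank_nth[OF M m(1) r'])
    qed
  next
    fix w u assume "w < n" "u < rounds n - Suc t"
    then show "\<not> ?v ! chain n (n + w) u" using vs(3) early next_pos by simp
  next
    fix w s assume w: "w < n" "s < n"
    show "?v ! chain n (n + w) (rounds n - Suc t + s) = holds M W (Suc t) w s"
    proof (cases s)
      case 0
      then show ?thesis using vs(3)[OF w(1)] early next_pos by simp
    next
      case (Suc s')
      let ?m = "W ! w ! s'"
      have s': "s' < n" using Suc w by simp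
      have m: "?m < n" using pref_table_nth_less[OF W w(1) s'] .
      have "chain n (n + w) (rounds n - Suc t + s) = g (?m * n + w)"
        using Suc next_pos by (simp add: fg_pair[OF m w(1)] pref_table_rank_nth[OF W w(1) s'])
      then show ?thesis
        using touched(2)[OF pair(1)[OF m w(1)]] vs(4)[OF w(1) s'] Suc
          vs(2)[OF m pref_table_rank(1)[OF M m w(1)]]
        by (auto simp: fg_pair[OF m w(1)] pref_table_rank_nth[OF W w(1) s'])
    qed
  next
    fix y assume "y < num_wires n" "cell_base n \<le> y"
    then show "\<not> ?v ! y" using vs(5) untouched[of y] fg_less by (metis imageE leD)
  qed
qed

lemma round_invariant_rounds:
  "t \<le> rounds n \<Longrightarrow> round_invariant t
     (fold apply_cgate (map (network_gate n M W w0) [0..<t * (n * n)]) (initial_wires n))"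
proof (induction t)
  case 0
  then show ?case by (simp add: round_invariant_initial)
next
  case (Suc t)
  have "Suc t * (n * n) = t * (n * n) + n * n" by simp
  then show ?case
    using round_invariant_step[OF _ Suc.IH] Suc.prems by (simp only: map_upt_add fold_append o_apply)
qed

lemma network_correct:
  assumes m0: "m0 < n" and w0: "w0 < n"
  shows "fold apply_cgate (network n M W w0) (initial_wires n) ! (result_base n + m0) \<longleftrightarrow>
    (\<exists>P. man_optimal n M W P \<and> (m0, w0) \<in> P)"
proof -
  define h where "h g = network_gate n M W w0 g" for g
  define s where "s = rounds n * (n * n)"
  define v1 where "v1 = fold apply_cgate (map h [0..<s]) (initial_wires n)"
  define v2 where "v2 = fold apply_cgate (map (\<lambda>x. h (s + x)) [0..<2 * n * n]) v1"
  define v3 where "v3 = fold apply_cgate (map (\<lambda>x. h (s + 2 * n * n + x)) [0..<n * n]) v2"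
  define v4 where "v4 = fold apply_cgate (map (\<lambda>x. h (s + 2 * n * n + n * n + x)) [0..<n * n]) v3"
  define v5 where "v5 = fold apply_cgate (map (\<lambda>x. h (s + 2 * n * n + n * n + n * n + x)) [0..<n]) v4"
  have len: "length v1 = num_wires n" "length v2 = num_wires n" "length v3 = num_wires n"
    "length v4 = num_wires n"
    by (simp_all add: v1_def v2_def v3_def v4_def length_fold_apply_cgate initial_wires_def)
  have v5: "fold apply_cgate (network n M W w0) (initial_wires n) = v5"
    unfolding network_def num_cgates_def map_upt_add fold_append
    by (simp add: v1_def v2_def v3_def v4_def v5_def s_def h_def[abs_def] add.assoc)
  have inv: "round_invariant (rounds n) v1"
    unfolding v1_def h_def s_def by (rule round_invariant_rounds) simp
  have v1: "\<And>m r. m < n \<Longrightarrow> r < n \<Longrightarrow> v1 ! chain n m r = proposes M W (rounds n) m r"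
    "\<And>w s. w < n \<Longrightarrow> s < n \<Longrightarrow> v1 ! chain n (n + w) s = holds M W (rounds n) w s"
    "\<And>y. y < num_wires n \<Longrightarrow> cell_base n \<le> y \<Longrightarrow> \<not> v1 ! y"
    using inv unfolding round_invariant_def by auto
  have pos: "r < chain_len n" if "r < n" for r using that by (simp add: chain_len_def)
  have xI: "x = y" if "x div n = y div n" "x mod n = y mod n" for x y
    using that by (metis div_mult_mod_eq)

  \<comment> \<open>After the last round the window starts at offset 0. As the cells are still
    False, the disjunction output copies the chain entry, now indexed by partner instead of
    position.\<close>
  define f2 where "f2 x = chain n (x div n) (x mod n)" for x
  define g2 where "g2 x = cell n (x div n) ((M @ W) ! (x div n) ! (x mod n))" for x
  have x2: "x div n < 2 * n" "x mod n < n" "(M @ W) ! (x div n) ! (x mod n) < n" if "x < 2 * n * n" for x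
    using digits_bounds[OF that] pref_table_nth_append by auto
  have fold2: "x < 2 * n * n \<Longrightarrow> v2 ! g2 x \<longleftrightarrow> v1 ! f2 x \<or> v1 ! g2 x"
    "y \<notin> f2 ` {0..<2 * n * n} \<Longrightarrow> y \<notin> g2 ` {0..<2 * n * n} \<Longrightarrow> v2 ! y = v1 ! y" for x y
  proof -
    have "inj_on f2 (set [0..<2 * n * n])"
      by (rule inj_onI) (auto simp: f2_def chain_eq_iff pos x2 intro: xI)
    moreover have "inj_on g2 (set [0..<2 * n * n])"
    proof (rule inj_onI)
      fix y z assume "y \<in> set [0..<2 * n * n]" "z \<in> set [0..<2 * n * n]" "g2 y = g2 z"
      then have yz: "y < 2 * n * n" "z < 2 * n * n" "y div n = z div n"
        "(M @ W) ! (y div n) ! (y mod n) = (M @ W) ! (z div n) ! (z mod n)"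
        by (auto simp: g2_def cell_eq_iff x2)
      then have "y mod n = z mod n"
        using pref_table_nth_append(2)[OF x2(1,2)] by metis
      with yz(3) show "y = z" by (rule xI)
    qed
    moreover have fg: "f2 x < cell_base n" "cell_base n \<le> g2 x" "g2 x < num_wires n" if "x < 2 * n * n" for x
      using x2[OF that] cell_less[of "x div n" n] wire_bounds[of n]
      by (auto simp: f2_def g2_def chain_less pos cell_ge intro: less_le_trans)
    moreover have "f2 ` set [0..<2 * n * n] \<inter> g2 ` set [0..<2 * n * n] = {}"
      using fg(1,2) by (fastforce simp: not_less)
    moreover have "h (s + x) = Comparator (f2 x) (g2 x)" if "x < 2 * n * n" for x
      using that by (simp add: h_def network_gate_def by_phase_def s_def f2_def g2_def)
    moreover have "f2 x < length v1 \<and> g2 x < length v1" if "x < 2 * n * n" for x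
      using fg[OF that] wire_bounds[of n] len by simp
    ultimately show "x < 2 * n * n \<Longrightarrow> v2 ! g2 x \<longleftrightarrow> v1 ! f2 x \<or> v1 ! g2 x"
      "y \<notin> f2 ` {0..<2 * n * n} \<Longrightarrow> y \<notin> g2 ` {0..<2 * n * n} \<Longrightarrow> v2 ! y = v1 ! y"
      unfolding v2_def
      using fold_disjoint_comparators(2,3)[of "[0..<2 * n * n]" f2 g2 v1 "\<lambda>x. h (s + x)"]
      by simp_all
  qed
  have v2_cell: "v2 ! cell n p q \<longleftrightarrow> v1 ! chain n p (rank ((M @ W) ! p) q)" if "p < 2 * n" "q < n" for p q
  proof -
    let ?r = "rank ((M @ W) ! p) q"
    have r: "?r < n" "(M @ W) ! p ! ?r = q" using that pref_table_nth_append by auto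
    then have x: "p * n + ?r < 2 * n * n" using that digits_less[of p "2 * n" ?r n] by simp
    have "f2 (p * n + ?r) = chain n p ?r" "g2 (p * n + ?r) = cell n p q"
      using r by (simp_all add: f2_def g2_def)
    moreover have "\<not> v1 ! cell n p q"
      using cell_less[OF that] wire_bounds[of n] by (intro v1 cell_ge) simp
    ultimately show ?thesis using fold2(1)[OF x] by simp
  qed
  have v2_result: "\<not> v2 ! (result_base n + m)" if "m < n" for m
  proof -
    have ne: "result_base n + m \<noteq> f2 x" "result_base n + m \<noteq> g2 x" if "x < 2 * n * n" for x
      using x2[OF that] chain_less[of "x div n" n "x mod n"]
        cell_less[of "x div n" n "(M @ W) ! (x div n) ! (x mod n)"] wire_bounds[of n]
      by (auto simp: f2_def g2_def pos)
    then have "v2 ! (result_base n + m) = v1 ! (result_base n + m)"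
      using ne by (intro fold2(2)) (metis atLeastLessThan_iff imageE)+
    then show ?thesis using v1(3)[of "result_base n + m"] that wire_bounds(1)[of n]
      by (simp add: num_wires_def)
  qed

  \<comment> \<open>The women's cells start after the \<open>n * n\<close> cells of the men.\<close>
  define f3 where "f3 x = cell_base n + n * n + x" for x
  have fold3: "x < n * n \<Longrightarrow> v3 ! f3 x \<longleftrightarrow> \<not> v2 ! f3 x"
    "y \<notin> f3 ` {0..<n * n} \<Longrightarrow> v3 ! y = v2 ! y" for x y
  proof -
    have "inj_on f3 (set [0..<n * n])" by (simp add: inj_on_def f3_def)
    moreover have "f3 x < length v2" if "x < n * n" for x
      using that by (simp add: len f3_def num_wires_def result_base_def)
    moreover have "h (s + 2 * n * n + x) = Negation (f3 x)" if "x < n * n" for x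
      using that by (simp add: h_def network_gate_def by_phase_def s_def f3_def)
    ultimately show "x < n * n \<Longrightarrow> v3 ! f3 x \<longleftrightarrow> \<not> v2 ! f3 x"
      "y \<notin> f3 ` {0..<n * n} \<Longrightarrow> v3 ! y = v2 ! y"
      unfolding v3_def
      using fold_negations[of "[0..<n * n]" f3 v2 "\<lambda>x. h (s + 2 * n * n + x)"] by simp_all
  qed
  have v3: "v3 ! cell n m w \<longleftrightarrow> proposes M W (rounds n) m (mrank m w)"
    "v3 ! cell n (n + w) m \<longleftrightarrow> \<not> holds M W (rounds n) w (wrank w m)"
    "\<not> v3 ! (result_base n + m)"
    if "m < n" "w < n" for m w
  proof -
    have len_M: "length M = n" using M by (simp add: pref_table_def)
    have "m * n + w < n * n" "w * n + m < n * n" using that by (auto intro: digits_less)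
    then have "cell n m w \<notin> f3 ` {0..<n * n}" "result_base n + m \<notin> f3 ` {0..<n * n}"
      "cell n (n + w) m = f3 (w * n + m)" "w * n + m < n * n"
      by (auto simp: cell_def f3_def result_base_def algebra_simps)
    then have "v3 ! cell n m w = v2 ! cell n m w" "v3 ! (result_base n + m) = v2 ! (result_base n + m)"
      "v3 ! cell n (n + w) m \<longleftrightarrow> \<not> v2 ! cell n (n + w) m"
      using fold3 by auto
    then show "v3 ! cell n m w \<longleftrightarrow> proposes M W (rounds n) m (mrank m w)"
      "v3 ! cell n (n + w) m \<longleftrightarrow> \<not> holds M W (rounds n) w (wrank w m)"
      "\<not> v3 ! (result_base n + m)"
      using that v2_cell[of m w] v2_cell[of "n + w" m] v2_result v1(1)[of m "mrank m w"]
        v1(2)[of w "wrank w m"] pref_table_rank(1)[OF M, of m w] pref_table_rank(1)[OF W, of w m]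
      by (auto simp: nth_append len_M)
  qed

  \<comment> \<open>Gate \<open>m * n + w\<close> meets the man's cell for \<open>w\<close> with the
    woman's cell for \<open>m\<close>; the conjunction ends up on the man's cell.\<close>
  define f4 where "f4 x = cell_base n + x" for x
  define g4 where "g4 x = cell n (n + x mod n) (x div n)" for x
  have x4: "x div n < n" "x mod n < n" if "x < n * n" for x
    using digits_bounds[OF that] by auto
  have g4: "cell_base n + n * n \<le> g4 x" "g4 x < result_base n" if "x < n * n" for x
    using x4[OF that] cell_less[of "n + x mod n" n "x div n"] by (simp_all add: g4_def cell_def algebra_simps)
  have fold4: "x < n * n \<Longrightarrow> v4 ! f4 x \<longleftrightarrow> v3 ! f4 x \<and> v3 ! g4 x"
    "y \<notin> f4 ` {0..<n * n} \<Longrightarrow> y \<notin> g4 ` {0..<n * n} \<Longrightarrow> v4 ! y = v3 ! y" for x y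
  proof -
    have "inj_on f4 (set [0..<n * n])" by (simp add: inj_on_def f4_def)
    moreover have "inj_on g4 (set [0..<n * n])"
      by (rule inj_onI) (auto simp: g4_def cell_eq_iff x4 intro: xI)
    moreover have "f4 ` set [0..<n * n] \<inter> g4 ` set [0..<n * n] = {}"
      using g4(1) by (fastforce simp: f4_def)
    moreover have "h (s + 2 * n * n + n * n + x) = Comparator (f4 x) (g4 x)" if "x < n * n" for x
      using that by (simp add: h_def network_gate_def by_phase_def s_def f4_def g4_def)
    moreover have "f4 x < length v3 \<and> g4 x < length v3" if "x < n * n" for x
      using g4[OF that] that wire_bounds[of n] by (simp add: f4_def len result_base_def)
    ultimately show "x < n * n \<Longrightarrow> v4 ! f4 x \<longleftrightarrow> v3 ! f4 x \<and> v3 ! g4 x"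
      "y \<notin> f4 ` {0..<n * n} \<Longrightarrow> y \<notin> g4 ` {0..<n * n} \<Longrightarrow> v4 ! y = v3 ! y"
      unfolding v4_def
      using fold_disjoint_comparators(1,3)[of "[0..<n * n]" f4 g4 v3 "\<lambda>x. h (s + 2 * n * n + n * n + x)"]
      by simp_all
  qed
  have v4_cell: "v4 ! cell n m0 w0 \<longleftrightarrow>
      proposes M W (rounds n) m0 (mrank m0 w0) \<and> \<not> holds M W (rounds n) w0 (wrank w0 m0)"
  proof -
    have "f4 (m0 * n + w0) = cell n m0 w0" "g4 (m0 * n + w0) = cell n (n + w0) m0" "m0 * n + w0 < n * n"
      using m0 w0 by (auto simp: f4_def g4_def cell_def intro: digits_less)
    then show ?thesis using fold4(1)[of "m0 * n + w0"] v3[OF m0 w0] by simp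
  qed
  have v4_result: "\<not> v4 ! (result_base n + m0)"
  proof -
    have "v4 ! (result_base n + m0) = v3 ! (result_base n + m0)"
      using g4(2) by (intro fold4(2)) (fastforce simp: f4_def result_base_def)+
    then show ?thesis using v3[OF m0 w0] by simp
  qed

  \<comment> \<open>Every man's cell for \<open>w0\<close> is copied to his blank result wire. So
    the designated woman enters through gate addresses and the designated man through the designated
    wire, both of which are copies of input blocks.\<close>
  have "v5 ! (result_base n + m0) \<longleftrightarrow> v4 ! cell n m0 w0 \<or> v4 ! (result_base n + m0)"
  proof -
    have "inj_on (\<lambda>m. cell n m w0) (set [0..<n])" using w0 by (simp add: inj_on_def cell_eq_iff)
    moreover have "inj_on (\<lambda>m. result_base n + m) (set [0..<n])" by (simp add: inj_on_def)
    moreover have c: "cell n m w0 < result_base n" if "m < n" for m using that w0 by (simp add: cell_less)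
    moreover have "(\<lambda>m. cell n m w0) ` set [0..<n] \<inter> (\<lambda>m. result_base n + m) ` set [0..<n] = {}"
      using c by fastforce
    moreover have "h (s + 2 * n * n + n * n + n * n + x) = Comparator (cell n x w0) (result_base n + x)"
      if "x < n" for x
      using that by (simp add: h_def network_gate_def by_phase_def s_def)
    moreover have "cell n m w0 < length v4 \<and> result_base n + m < length v4" if "m < n" for m
      using c[OF that] that by (simp add: len num_wires_def)
    ultimately show ?thesis
      unfolding v5_def
      using fold_disjoint_comparators(2)[of "[0..<n]" "\<lambda>m. cell n m w0" "\<lambda>m. result_base n + m" v4
          "\<lambda>x. h (s + 2 * n * n + n * n + n * n + x)" m0] m0
      by simp
  qed
  then show ?thesis
    unfolding v5 man_optimal_pair_iff[OF m0 w0] using v4_cell v4_result by simp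
qed

end

section \<open>The reduction as a projection\<close>

text \<open>Sources for a one-hot block with index \<open>a + x\<close>, where \<open>x < l\<close>
  is itself one-hot in the input, at sources \<open>i\<close>, \<open>i + s\<close>,
  \<open>i + 2 * s\<close> and so on. A fixed index \<open>a\<close> is the case
  \<open>l = 1\<close>, \<open>i = 1\<close>, \<open>s = 0\<close>, where the single source is the
  constant True.\<close>

definition window :: "nat \<Rightarrow> nat \<Rightarrow> nat \<Rightarrow> nat \<Rightarrow> nat \<Rightarrow> nat" where
  "window a l i s p = (if a \<le> p \<and> p < a + l then i + (p - a) * s else 0)"

definition instance_length :: "nat \<Rightarrow> nat" where
  "instance_length n = n + 1 + 2 * n * n * n + n + n"

text \<open>Sources are input positions shifted by 2, since sources 0 and 1 are the constants.\<close>

definition table_source :: "nat \<Rightarrow> nat \<Rightarrow> nat \<Rightarrow> nat \<Rightarrow> nat" where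
  "table_source n p r q = n + 3 + (p * n + r) * n + q"

definition man_source :: "nat \<Rightarrow> nat" where
  "man_source n = n + 3 + 2 * n * n * n"

definition woman_source :: "nat \<Rightarrow> nat" where
  "woman_source n = n + 3 + 2 * n * n * n + n"

text \<open>The type bits of comparators and negations are read off the terminating \<open>False\<close> and the
  \<open>True\<close> bits of the unary size, so that a wrong size field makes the circuit malformed.\<close>

definition type_source :: "nat \<Rightarrow> nat \<Rightarrow> nat" where
  "type_source n g = by_phase n (\<lambda>_. n + 2) (\<lambda>_. n + 2) (\<lambda>x. x div n + 2) (\<lambda>_. n + 2) (\<lambda>_. n + 2) g"

text \<open>In a round the address depends on the rank of a fixed partner, so the window runs down a
  column of the table, with stride \<open>n\<close>. The second wire in the phase of moving to the
  cells depends on the partner at a fixed rank, so its window in \<open>snd_source\<close> runs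
  along a row, with stride 1.\<close>

definition fst_source :: "nat \<Rightarrow> nat \<Rightarrow> nat \<Rightarrow> nat" where
  "fst_source n g y = by_phase n
    (\<lambda>g. window (chain n (g mod (n * n) div n) (rounds n - g div (n * n))) n
           (table_source n (g mod (n * n) div n) 0 (g mod n)) n y)
    (\<lambda>x. window (chain n (x div n) (x mod n)) 1 1 0 y)
    (\<lambda>x. window (cell_base n + n * n + x) 1 1 0 y)
    (\<lambda>x. window (cell_base n + x) 1 1 0 y)
    (\<lambda>m. window (cell n m 0) n (woman_source n) 1 y) g"

definition snd_source :: "nat \<Rightarrow> nat \<Rightarrow> nat \<Rightarrow> nat" where
  "snd_source n g y = by_phase n
    (\<lambda>g. window (chain n (n + g mod n) (rounds n - g div (n * n))) n
           (table_source n (n + g mod n) 0 (g mod (n * n) div n)) n y)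
    (\<lambda>x. window (cell n (x div n) 0) n (table_source n (x div n) (x mod n) 0) 1 y)
    (\<lambda>x. 0)
    (\<lambda>x. window (cell n (n + x mod n) (x div n)) 1 1 0 y)
    (\<lambda>m. window (result_base n + m) 1 1 0 y) g"

definition initial_source :: "nat \<Rightarrow> nat \<Rightarrow> nat" where
  "initial_source n y = (if y < n * chain_len n \<and> y mod chain_len n \<le> rounds n then 1 else 0)"

definition designated_source :: "nat \<Rightarrow> nat \<Rightarrow> nat" where
  "designated_source n y = window (result_base n) n (man_source n) 1 y"

definition gate_bits :: "nat \<Rightarrow> bool list \<Rightarrow> nat \<Rightarrow> bool list" where
  "gate_bits n X g = source_bit X (type_source n g) #
     map (\<lambda>y. source_bit X (fst_source n g y)) [0..<num_wires n] @
     map (\<lambda>y. source_bit X (snd_source n g y)) [0..<num_wires n]"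

definition reduction :: "nat \<Rightarrow> bool list \<Rightarrow> bool list" where
  "reduction n X = unary (num_wires n) @ unary (num_cgates n) @
     concat (map (gate_bits n X) [0..<num_cgates n]) @
     map (\<lambda>y. source_bit X (initial_source n y)) [0..<num_wires n] @
     map (\<lambda>y. source_bit X (designated_source n y)) [0..<num_wires n]"

definition output_length :: "nat \<Rightarrow> nat" where
  "output_length n = (num_wires n + 1) + ((num_cgates n + 1) +
     (num_cgates n * (2 * num_wires n + 1) + (num_wires n + num_wires n)))"

definition gate_bit_source :: "nat \<Rightarrow> nat \<Rightarrow> nat \<Rightarrow> nat" where
  "gate_bit_source n g b = (if b = 0 then type_source n g
     else if b < 1 + num_wires n then fst_source n g (b - 1)
     else snd_source n g (b - (1 + num_wires n)))"

definition body_source :: "nat \<Rightarrow> nat \<Rightarrow> nat" where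
  "body_source n j =
    (if j < num_cgates n * (2 * num_wires n + 1)
       then gate_bit_source n (j div (2 * num_wires n + 1)) (j mod (2 * num_wires n + 1))
     else if j - num_cgates n * (2 * num_wires n + 1) < num_wires n
       then initial_source n (j - num_cgates n * (2 * num_wires n + 1))
     else designated_source n (j - num_cgates n * (2 * num_wires n + 1) - num_wires n))"

definition output_source :: "nat \<Rightarrow> nat \<Rightarrow> nat" where
  "output_source n j =
    (if j < num_wires n + 1 then if j < num_wires n then 1 else 0
     else if j - (num_wires n + 1) < num_cgates n + 1 then
       if j - (num_wires n + 1) < num_cgates n then 1 else 0
     else body_source n (j - (num_wires n + 1) - (num_cgates n + 1)))"

section \<open>The reduction as a definable map from output positions to sources\<close>

lemma source_bit_const: "source_bit X 0 = False" "source_bit X (Suc 0) = True"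
  by (simp_all add: source_bit_def)

lemma concat_map_upt:
  assumes "\<And>x. x < c \<Longrightarrow> f x = map (h x) [0..<l]"
  shows "concat (map f [0..<c]) = map (\<lambda>j. h (j div l) (j mod l)) [0..<c * l]"
  using assms
proof (induction c)
  case (Suc c)
  have "Suc c * l = c * l + l" by simp
  moreover have "f c = map (\<lambda>y. h ((c * l + y) div l) ((c * l + y) mod l)) [0..<l]"
    using Suc.prems[of c] digits_div_mod[of _ l c] by simp
  ultimately show ?case using Suc by (simp only: map_upt_add) simp
qed simp

lemma unary_eq_map: "unary k = map (\<lambda>j. j < k) [0..<k + 1]"
  by (rule nth_equalityI) (auto simp: unary_def nth_append)

text \<open>\<open>reduction\<close> follows the layout of \<open>encode_ccv_instance\<close>, which
  suits correctness; the right-hand side has the form that \<open>projection_uniform_AC0\<close>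
  expects.\<close>

lemma reduction_eq_map:
  "reduction n X = map (\<lambda>j. source_bit X (output_source n j)) [0..<output_length n]"
proof -
  let ?k = "num_wires n"
  have "gate_bits n X g = map (\<lambda>b. source_bit X (gate_bit_source n g b)) [0..<1 + (?k + ?k)]" for g
    unfolding map_upt_add by (simp add: gate_bits_def gate_bit_source_def)
  then have gates: "concat (map (gate_bits n X) [0..<num_cgates n]) =
      map (\<lambda>j. source_bit X (gate_bit_source n (j div (2 * ?k + 1)) (j mod (2 * ?k + 1))))
        [0..<num_cgates n * (2 * ?k + 1)]"
    by (intro concat_map_upt) (simp add: mult_2)
  have un: "unary k = map (\<lambda>j. source_bit X (if j < k then 1 else 0)) [0..<k + 1]" for k
    unfolding unary_eq_map by (simp add: source_bit_def)
  show ?thesis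
    unfolding reduction_def output_length_def map_upt_add[of _ "_ + 1"] map_upt_add[of _ "_ * _"]
      map_upt_add[of _ "?k" "?k"] gates un
    by (intro arg_cong2[where f = append] map_cong refl)
      (auto simp: output_source_def body_source_def)
qed

lemma definable_by_phase:
  assumes "definable_fun n" "definable_fun g"
    and "\<And>x. definable_fun x \<Longrightarrow> definable_fun (\<lambda>e. f1 e (x e))"
    and "\<And>x. definable_fun x \<Longrightarrow> definable_fun (\<lambda>e. f2 e (x e))"
    and "\<And>x. definable_fun x \<Longrightarrow> definable_fun (\<lambda>e. f3 e (x e))"
    and "\<And>x. definable_fun x \<Longrightarrow> definable_fun (\<lambda>e. f4 e (x e))"
    and "\<And>x. definable_fun x \<Longrightarrow> definable_fun (\<lambda>e. f5 e (x e))"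
  shows "definable_fun (\<lambda>e. by_phase (n e) (\<lambda>x. f1 e x) (\<lambda>x. f2 e x) (\<lambda>x. f3 e x) (\<lambda>x. f4 e x)
    (\<lambda>x. f5 e x) (g e))"
  unfolding by_phase_def rounds_def by (intro definable_intros assms)

lemma definable_sizes:
  assumes "definable_fun n"
  shows "definable_fun (\<lambda>e. rounds (n e))" "definable_fun (\<lambda>e. chain_len (n e))"
    "definable_fun (\<lambda>e. cell_base (n e))" "definable_fun (\<lambda>e. result_base (n e))"
    "definable_fun (\<lambda>e. num_wires (n e))" "definable_fun (\<lambda>e. num_cgates (n e))"
    "definable_fun (\<lambda>e. output_length (n e))" "definable_fun (\<lambda>e. instance_length (n e))"
    "definable_fun (\<lambda>e. man_source (n e))" "definable_fun (\<lambda>e. woman_source (n e))"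
  unfolding instance_length_def output_length_def num_cgates_def num_wires_def result_base_def
    cell_base_def chain_len_def rounds_def man_source_def woman_source_def
  by (intro definable_intros assms)+

lemma definable_wires:
  assumes "definable_fun n" "definable_fun p" "definable_fun u" "definable_fun r"
  shows "definable_fun (\<lambda>e. chain (n e) (p e) (u e))" "definable_fun (\<lambda>e. cell (n e) (p e) (u e))"
    "definable_fun (\<lambda>e. table_source (n e) (p e) (r e) (u e))"
  unfolding chain_def cell_def table_source_def
  by (intro definable_intros definable_sizes assms)+

lemma definable_window:
  assumes "definable_fun a" "definable_fun l" "definable_fun i" "definable_fun s" "definable_fun y"
  shows "definable_fun (\<lambda>e. window (a e) (l e) (i e) (s e) (y e))"
  unfolding window_def by (intro definable_intros assms)

text \<open>The position of each output bit is decoded by comparisons, subtraction,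
  \<open>div\<close> and \<open>mod\<close>, and its source is polynomial in the decoded numbers;
  all this preserves definability.\<close>

lemma definable_output_source:
  assumes "definable_fun n" "definable_fun j"
  shows "definable_fun (\<lambda>e. output_source (n e) (j e))"
  unfolding output_source_def body_source_def gate_bit_source_def type_source_def fst_source_def
    snd_source_def initial_source_def designated_source_def
  by (intro definable_intros definable_sizes definable_wires definable_window definable_by_phase assms;
      assumption)

section \<open>Encoded instances\<close>

lemma length_concat_uniform:
  "\<forall>ys\<in>set yss. length ys = l \<Longrightarrow> length (concat yss) = length yss * l"
  by (induction yss) auto

lemma nth_concat_uniform:
  assumes "\<forall>ys\<in>set yss. length ys = l" "a < length yss" "b < l"
  shows "concat yss ! (a * l + b) = yss ! a ! b"
  using assms
proof (induction yss arbitrary: a)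
  case (Cons ys yss)
  then show ?case by (cases a) (auto simp: nth_append)
qed simp

lemma length_block: "length (block k a) = k"
  by (simp add: block_def)

lemma nth_block: "i < k \<Longrightarrow> block k a ! i \<longleftrightarrow> i = a"
  by (simp add: block_def)

lemma block_inject: "a < k \<Longrightarrow> block k a = block k b \<Longrightarrow> a = b"
  using nth_block[of a k a] nth_block[of a k b] by simp

lemma length_unary: "length (unary k) = k + 1"
  by (simp add: unary_def)

lemma unary_append_eq_iff: "unary a @ xs = unary b @ ys \<longleftrightarrow> a = b \<and> xs = ys"
proof (induction a arbitrary: b)
  case 0
  show ?case by (cases b) (auto simp: unary_def)
next
  case (Suc a)
  show ?case
  proof (cases b)
    case 0
    then show ?thesis by (simp add: unary_def)
  next
    case (Suc b')
    then show ?thesis using Suc.IH[of b'] by (simp add: unary_def)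
  qed
qed

definition is_table :: "nat \<Rightarrow> nat list list \<Rightarrow> bool" where
  "is_table n T \<longleftrightarrow> length T = n \<and> (\<forall>L\<in>set T. length L = n)"

lemma pref_table_is_table: "pref_table n T \<Longrightarrow> is_table n T"
  using pref_table_row(1) unfolding is_table_def pref_table_def by (metis in_set_conv_nth)

lemma encode_table_append: "encode_table n S @ encode_table n T = encode_table n (S @ T)"
  by (simp add: encode_table_def)

lemma
  assumes "\<forall>L\<in>set T. length L = n"
  shows length_encode_table: "length (encode_table n T) = length T * (n * n)"
    and nth_encode_table: "p < length T \<Longrightarrow> r < n \<Longrightarrow> q < n \<Longrightarrow>
      encode_table n T ! ((p * n + r) * n + q) \<longleftrightarrow> T ! p ! r = q"
proof -
  have row: "length (concat (map (block n) L)) = n * n" if "L \<in> set T" for L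
    using that assms by (subst length_concat_uniform[of _ n]) (auto simp: length_block)
  then show "length (encode_table n T) = length T * (n * n)"
    unfolding encode_table_def by (subst length_concat_uniform[of _ "n * n"]) auto
  assume p: "p < length T" "r < n" "q < n"
  have "encode_table n T ! (p * (n * n) + (r * n + q)) = concat (map (block n) (T ! p)) ! (r * n + q)"
    unfolding encode_table_def using p row
    by (subst nth_concat_uniform) (auto intro: digits_less)
  also have "\<dots> = block n (T ! p ! r) ! q"
    using p assms by (subst nth_concat_uniform) (auto simp: length_block)
  finally show "encode_table n T ! ((p * n + r) * n + q) \<longleftrightarrow> T ! p ! r = q"
    using p by (auto simp: nth_block algebra_simps)
qed

text \<open>The bitwise form of being an encoded instance (see \<open>encodes_iff\<close>).
  Projections, checks for malformed inputs and the exchange of the sexes all speak about single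
  bits.\<close>

definition encodes :: "nat \<Rightarrow> nat list list \<Rightarrow> nat list list \<Rightarrow> nat \<Rightarrow> nat \<Rightarrow> bool list \<Rightarrow> bool" where
  "encodes n M W m w X \<longleftrightarrow> length X = instance_length n \<and> (\<forall>i<n. source_bit X (i + 2)) \<and>
    \<not> source_bit X (n + 2) \<and>
    (\<forall>p<2 * n. \<forall>r<n. \<forall>q<n. source_bit X (table_source n p r q) \<longleftrightarrow> (M @ W) ! p ! r = q) \<and>
    (\<forall>q<n. source_bit X (man_source n + q) \<longleftrightarrow> q = m) \<and>
    (\<forall>q<n. source_bit X (woman_source n + q) \<longleftrightarrow> q = w)"

lemma source_bit_nth: "2 \<le> i \<Longrightarrow> i < length X + 2 \<Longrightarrow> source_bit X i = X ! (i - 2)"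
  by (auto simp: source_bit_def)

lemma table_index_less:
  assumes "p < 2 * n" "r < n" "q < (n :: nat)" shows "(p * n + r) * n + q < 2 * n * n * n"
  using digits_less[OF digits_less[OF assms(1,2)] assms(3)] by simp

lemma encodes_encode_marriage_instance:
  assumes "is_table n M" "is_table n W"
  shows "encodes n M W m w (encode_marriage_instance n M W m w)"
proof -
  let ?X = "encode_marriage_instance n M W m w"
  have tab: "\<forall>L\<in>set (M @ W). length L = n" "length (M @ W) = 2 * n"
    using assms by (auto simp: is_table_def)
  have X: "?X = unary n @ encode_table n (M @ W) @ block n m @ block n w"
    by (simp add: encode_marriage_instance_def flip: encode_table_append)
  have len: "length ?X = instance_length n"
    unfolding X using length_encode_table[OF tab(1)] tab(2)
    by (simp add: length_unary length_block instance_length_def)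
  have T: "length (encode_table n (M @ W)) = 2 * n * n * n"
    using length_encode_table[OF tab(1)] tab(2) by simp
  show ?thesis
    unfolding encodes_def
  proof (intro conjI allI impI)
    show "length ?X = instance_length n" by (rule len)
    show "source_bit ?X (i + 2)" if "i < n" for i
      using that by (subst source_bit_nth)
        (auto simp: len instance_length_def X nth_append length_unary, simp add: unary_def nth_append)
    show "\<not> source_bit ?X (n + 2)"
      by (subst source_bit_nth)
        (auto simp: len instance_length_def X nth_append length_unary, simp add: unary_def nth_append)
    show "source_bit ?X (table_source n p r q) \<longleftrightarrow> (M @ W) ! p ! r = q"
      if "p < 2 * n" "r < n" "q < n" for p r q
    proof -
      have i: "(p * n + r) * n + q < 2 * n * n * n" using that by (rule table_index_less)
      then have "source_bit ?X (table_source n p r q) = ?X ! (n + 1 + ((p * n + r) * n + q))"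
        by (subst source_bit_nth) (auto simp: len instance_length_def table_source_def)
      also have "\<dots> = encode_table n (M @ W) ! ((p * n + r) * n + q)"
        unfolding X using i T by (simp add: nth_append length_unary)
      finally show ?thesis using nth_encode_table[OF tab(1), of p r q] tab(2) that by simp
    qed
    show "source_bit ?X (man_source n + q) \<longleftrightarrow> q = m" if "q < n" for q
      using that by (subst source_bit_nth)
        (auto simp: len instance_length_def man_source_def X nth_append length_unary T length_block nth_block)
    show "source_bit ?X (woman_source n + q) \<longleftrightarrow> q = w" if "q < n" for q
      using that by (subst source_bit_nth)
        (auto simp: len instance_length_def woman_source_def X nth_append length_unary T length_block nth_block)
  qed
qed

lemma instance_source_cases:
  assumes "i < instance_length n"
  obtains (size) "i < n" | (stop) "i = n"
    | (table) p r q where "p < 2 * n" "r < n" "q < n" "i + 2 = table_source n p r q"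
    | (man) q where "q < n" "i + 2 = man_source n + q"
    | (woman) q where "q < n" "i + 2 = woman_source n + q"
proof -
  consider "i < n" | "i = n" | "n + 1 \<le> i" "i < n + 1 + 2 * n * n * n"
    | "n + 1 + 2 * n * n * n \<le> i" "i < n + 1 + 2 * n * n * n + n"
    | "n + 1 + 2 * n * n * n + n \<le> i" by linarith
  then show thesis
  proof cases
    case 3
    define j where "j = i - (n + 1)"
    have j: "j < 2 * n * n * n" "i = n + 1 + j" using 3 by (auto simp: j_def)
    then have "j div n < 2 * n * n" "j mod n < n" "j div n * n + j mod n = j"
      using digits_bounds[of j "2 * n * n" n] by auto
    moreover from this have "j div n div n < 2 * n" "j div n mod n < n"
      "j div n div n * n + j div n mod n = j div n"
      using digits_bounds[of "j div n" "2 * n" n] by auto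
    ultimately show thesis using j
      by (intro table[of "j div n div n" "j div n mod n" "j mod n"]) (auto simp: table_source_def)
  next
    case 4
    then show thesis by (intro man[of "i - (n + 1 + 2 * n * n * n)"]) (auto simp: man_source_def)
  next
    case 5
    then show thesis using assms
      by (intro woman[of "i - (n + 1 + 2 * n * n * n + n)"]) (auto simp: woman_source_def instance_length_def)
  qed (use size stop in auto)
qed

text \<open>The fields described by \<open>encodes\<close> cover all positions below
  \<open>instance_length n\<close>, so no bit is left free.\<close>

lemma encodes_unique:
  assumes X: "encodes n M W m w X" and Y: "encodes n M W m w Y" shows "X = Y"
proof (rule nth_equalityI)
  show len: "length X = length Y" using X Y by (simp add: encodes_def)
  fix i assume i: "i < length X"
  then have "i < instance_length n" using X by (simp add: encodes_def)
  then have "source_bit X (i + 2) = source_bit Y (i + 2)"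
    by (cases rule: instance_source_cases) (use X Y in \<open>auto simp: encodes_def\<close>)
  then show "X ! i = Y ! i" using i len by (simp add: source_bit_nth)
qed

lemma encodes_iff:
  "is_table n M \<Longrightarrow> is_table n W \<Longrightarrow> encodes n M W m w X \<longleftrightarrow> X = encode_marriage_instance n M W m w"
  using encodes_unique encodes_encode_marriage_instance by blast

lemma length_encode_cgate: "length (encode_cgate k g) = 2 * k + 1"
  by (cases g) (simp_all add: length_block)

lemma length_gate_bits: "length (gate_bits n X g) = 2 * num_wires n + 1"
  by (simp add: gate_bits_def)

lemma encode_cgate_inject:
  assumes "wf_cgate k g" "encode_cgate k g = encode_cgate k g'" shows "g = g'"
  using assms by (cases g; cases g') (auto simp: length_block dest: block_inject)

lemma concat_map_eq_iff:
  assumes "length xs = length ys" "\<And>x. length (f x) = l" "\<And>y. length (g y) = l"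
  shows "concat (map f xs) = concat (map g ys) \<longleftrightarrow> map f xs = map g ys"
  using assms by (intro concat_eq_concat_iff) (auto simp: zip_map_map)

text \<open>Membership in \<open>CcvNeg\<close> hides the circuit behind an existential, and this
  lemma recovers it. Well-formedness enters because blocks with indices out of range are all False
  and cannot be told apart.\<close>

lemma encode_ccv_instance_eqD:
  assumes "encode_ccv_instance gs v c = encode_ccv_instance gs' v' c'"
    and "\<forall>g\<in>set gs. wf_cgate (length v) g" "c < length v"
  shows "gs = gs' \<and> v = v' \<and> c = c'"
proof -
  let ?k = "length v"
  let ?enc = "\<lambda>gs. concat (map (encode_cgate ?k) gs)"
  have len: "length v' = ?k" "length gs' = length gs"
    and eq: "?enc gs @ v @ block ?k c = ?enc gs' @ v' @ block ?k c'"
    using assms(1) by (auto simp: encode_ccv_instance_def unary_append_eq_iff)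
  have "length (?enc hs) = length hs * (2 * ?k + 1)" for hs
    by (subst length_concat_uniform[of _ "2 * ?k + 1"]) (auto simp: length_encode_cgate)
  then have eqs: "?enc gs = ?enc gs'" "v = v'" "block ?k c = block ?k c'"
    using eq len by (auto simp: append_eq_append_conv)
  have "map (encode_cgate ?k) gs = map (encode_cgate ?k) gs'"
    using eqs(1) len by (subst (asm) concat_map_eq_iff) (auto simp: length_encode_cgate)
  have "gs = gs'"
  proof (rule nth_equalityI)
    fix i assume i: "i < length gs"
    then have "encode_cgate ?k (gs ! i) = encode_cgate ?k (gs' ! i)"
      using arg_cong[OF \<open>map _ gs = _\<close>, of "\<lambda>l. l ! i"] len by simp
    then show "gs ! i = gs' ! i" using assms(2) i by (intro encode_cgate_inject[of ?k]) auto
  qed (simp add: len)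
  then show ?thesis using eqs(2,3) block_inject assms(3) by blast
qed

lemma block_window:
  assumes "a < l" "\<And>x. x < l \<Longrightarrow> source_bit X (i + x * s) \<longleftrightarrow> x = a"
  shows "map (\<lambda>y. source_bit X (window b l i s y)) [0..<k] = block k (b + a)"
  unfolding block_def
proof (rule map_cong[OF refl])
  fix y
  show "source_bit X (window b l i s y) \<longleftrightarrow> y = b + a"
    using assms(1) assms(2)[of "y - b"] by (auto simp: window_def source_bit_const)
qed

lemma block_window_single: "map (\<lambda>y. source_bit X (window b 1 1 0 y)) [0..<k] = block k b"
  using block_window[of 0 1 X 1 0 b k] by (simp add: source_bit_const)

text \<open>The converse direction, for inputs not known to be valid: all bits outside the window
  are False, so the single True of a genuine block lies inside, and the input bits read there are
  one-hot.\<close>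

lemma block_windowD:
  assumes "map (\<lambda>y. source_bit X (window b l i s y)) [0..<k] = block k a" "a < k" "b + l \<le> k"
  shows "\<exists>y<l. \<forall>x<l. source_bit X (i + x * s) \<longleftrightarrow> x = y"
proof -
  have bit: "source_bit X (window b l i s y) \<longleftrightarrow> y = a" if "y < k" for y
    using that assms(1) unfolding block_def by (simp add: map_eq_conv)
  have a: "b \<le> a" "a < b + l"
    using bit[OF assms(2)] by (auto simp: window_def source_bit_const split: if_splits)
  have "source_bit X (i + x * s) \<longleftrightarrow> x = a - b" if "x < l" for x
    using bit[of "b + x"] that assms(3) a by (auto simp: window_def)
  then show ?thesis using a by (intro exI[of _ "a - b"]) auto
qed

lemma by_phase_simps:
  "g < rounds n * (n * n) \<Longrightarrow> by_phase n f1 f2 f3 f4 f5 g = f1 g"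
  "x < 2 * n * n \<Longrightarrow> by_phase n f1 f2 f3 f4 f5 (rounds n * (n * n) + x) = f2 x"
  "x < n * n \<Longrightarrow> by_phase n f1 f2 f3 f4 f5 (rounds n * (n * n) + 2 * n * n + x) = f3 x"
  "x < n * n \<Longrightarrow> by_phase n f1 f2 f3 f4 f5 (rounds n * (n * n) + 2 * n * n + n * n + x) = f4 x"
  "x < n \<Longrightarrow> by_phase n f1 f2 f3 f4 f5 (rounds n * (n * n) + 2 * n * n + n * n + n * n + x) = f5 x"
  by (simp_all add: by_phase_def)

lemma phase_cases:
  assumes "g < num_cgates n"
  obtains (1) "g < rounds n * (n * n)"
    | (2) x where "x < 2 * n * n" "g = rounds n * (n * n) + x"
    | (3) x where "x < n * n" "g = rounds n * (n * n) + 2 * n * n + x"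
    | (4) x where "x < n * n" "g = rounds n * (n * n) + 2 * n * n + n * n + x"
    | (5) x where "x < n" "g = rounds n * (n * n) + 2 * n * n + n * n + n * n + x"
proof -
  consider "g < rounds n * (n * n)"
    | "rounds n * (n * n) \<le> g" "g - rounds n * (n * n) < 2 * n * n"
    | "rounds n * (n * n) + 2 * n * n \<le> g" "g - (rounds n * (n * n) + 2 * n * n) < n * n"
    | "rounds n * (n * n) + 2 * n * n + n * n \<le> g"
      "g - (rounds n * (n * n) + 2 * n * n + n * n) < n * n"
    | "rounds n * (n * n) + 2 * n * n + n * n + n * n \<le> g"
    by linarith
  then show thesis
  proof cases
    case 5
    then show thesis using assms
      by (intro that(5)[of "g - (rounds n * (n * n) + 2 * n * n + n * n + n * n)"])
        (auto simp: num_cgates_def)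
  qed (metis that le_add_diff_inverse)+
qed

lemma phase_less:
  "g < rounds n * (n * n) \<Longrightarrow> g < num_cgates n"
  "x < 2 * n * n \<Longrightarrow> rounds n * (n * n) + x < num_cgates n"
  "x < n * n \<Longrightarrow> rounds n * (n * n) + 2 * n * n + x < num_cgates n"
  "x < n * n \<Longrightarrow> rounds n * (n * n) + 2 * n * n + n * n + x < num_cgates n"
  "x < n \<Longrightarrow> rounds n * (n * n) + 2 * n * n + n * n + n * n + x < num_cgates n"
  by (simp_all add: num_cgates_def)

lemmas gate_source_defs = gate_bits_def type_source_def fst_source_def snd_source_def network_gate_def

context stable_marriage
begin

lemma nth_append_tables: "m < n \<Longrightarrow> (M @ W) ! m = M ! m" "(M @ W) ! (n + w) = W ! w"
  using M by (auto simp: pref_table_def nth_append)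

lemma gate_bits_eq_encode:
  assumes X: "encodes n M W m w X" and w: "w < n" and g: "g < num_cgates n"
  shows "gate_bits n X g = encode_cgate (num_wires n) (network_gate n M W w g)"
proof -
  have bits: "\<And>i. i < n \<Longrightarrow> source_bit X (i + 2)" "\<not> source_bit X (n + 2)"
    "\<And>p r q. p < 2 * n \<Longrightarrow> r < n \<Longrightarrow> q < n \<Longrightarrow> source_bit X (table_source n p r q) \<longleftrightarrow> (M @ W) ! p ! r = q"
    "\<And>q. q < n \<Longrightarrow> source_bit X (woman_source n + q) \<longleftrightarrow> q = w"
    using X unfolding encodes_def by blast+
  \<comment> \<open>Steps of length \<open>n\<close> run through the ranks at which \<open>p\<close>
    may list \<open>q\<close>; as the list is a permutation, exactly one of them fits.\<close>
  have column: "source_bit X (table_source n p 0 q + r * n) \<longleftrightarrow> r = rank ((M @ W) ! p) q"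
    if "p < 2 * n" "q < n" "r < n" for p q r
  proof -
    have "table_source n p 0 q + r * n = table_source n p r q" by (simp add: table_source_def algebra_simps)
    then show ?thesis using bits(3) that pref_table_nth_append[OF that(1)] by metis
  qed
  have row: "source_bit X (table_source n p r 0 + q * 1) \<longleftrightarrow> q = (M @ W) ! p ! r"
    if "p < 2 * n" "q < n" "r < n" for p q r
    using bits(3)[OF that(1,3,2)] by (auto simp: table_source_def)
  show ?thesis
    using g
  proof (cases rule: phase_cases)
    case 1
    let ?m = "g mod (n * n) div n" let ?w = "g mod n" let ?t = "g div (n * n)"
    have "0 < n" using w by simp
    then have "g mod (n * n) < n * n" by (intro mod_less_divisor) simp
    then have mw: "?m < n" "?w < n" using \<open>0 < n\<close> digits_bounds(1) by auto
    have "map (\<lambda>y. source_bit X (window (chain n ?m (rounds n - ?t)) n (table_source n ?m 0 ?w) n y))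
        [0..<num_wires n] = block (num_wires n) (chain n ?m (rounds n - ?t) + rank ((M @ W) ! ?m) ?w)"
      using mw pref_table_nth_append(3)[of ?m ?w] by (intro block_window column) auto
    moreover have "map (\<lambda>y. source_bit X (window (chain n (n + ?w) (rounds n - ?t)) n
          (table_source n (n + ?w) 0 ?m) n y)) [0..<num_wires n] =
        block (num_wires n) (chain n (n + ?w) (rounds n - ?t) + rank ((M @ W) ! (n + ?w)) ?m)"
      using mw pref_table_nth_append(3)[of "n + ?w" ?m] by (intro block_window column) auto
    ultimately show ?thesis
      using mw bits(2) 1
      by (simp add: gate_source_defs by_phase_simps Let_def chain_def nth_append_tables add.assoc)
  next
    case (2 x)
    then have x: "x div n < 2 * n" "x mod n < n" using digits_bounds by blast+
    have "map (\<lambda>y. source_bit X (window (cell n (x div n) 0) n (table_source n (x div n) (x mod n) 0) 1 y))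
        [0..<num_wires n] = block (num_wires n) (cell n (x div n) 0 + (M @ W) ! (x div n) ! (x mod n))"
      using x pref_table_nth_append(1)[OF x] by (intro block_window row) auto
    then show ?thesis
      using bits(2) 2 by (simp add: gate_source_defs by_phase_simps block_window_single[simplified] cell_def)
  next
    case (3 x)
    then have "x div n < n" using digits_bounds by blast
    then show ?thesis
      using bits(1) 3
      by (simp add: gate_source_defs by_phase_simps block_window_single[simplified] source_bit_const
          map_replicate_const)
  next
    case (4 x)
    then show ?thesis
      using bits(2)
      by (simp only: gate_source_defs by_phase_simps(4) block_window_single encode_cgate.simps)
  next
    case (5 x)
    have "map (\<lambda>y. source_bit X (window (cell n x 0) n (woman_source n) 1 y)) [0..<num_wires n] =
        block (num_wires n) (cell n x 0 + w)"
      using w bits(4) by (intro block_window) auto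
    then show ?thesis
      using bits(2) 5
      by (simp only: gate_source_defs by_phase_simps(5) block_window_single encode_cgate.simps)
        (simp add: cell_def)
  qed
qed

lemma reduction_encodes:
  assumes X: "encodes n M W m w X" and m: "m < n" and w: "w < n"
  shows "reduction n X = encode_ccv_instance (network n M W w) (initial_wires n) (result_base n + m)"
proof -
  have "map (gate_bits n X) [0..<num_cgates n] = map (encode_cgate (num_wires n)) (network n M W w)"
    using gate_bits_eq_encode[OF X w] by (simp add: network_def)
  moreover have "map (\<lambda>y. source_bit X (initial_source n y)) [0..<num_wires n] = initial_wires n"
    by (auto simp: initial_source_def initial_wires_def initial_wire_def source_bit_const)
  moreover have "map (\<lambda>y. source_bit X (designated_source n y)) [0..<num_wires n] =
      block (num_wires n) (result_base n + m)"
    unfolding designated_source_def using X m by (intro block_window) (auto simp: encodes_def)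
  moreover have "length (initial_wires n) = num_wires n" "length (network n M W w) = num_cgates n"
    by (simp_all add: initial_wires_def network_def)
  ultimately show ?thesis by (simp add: reduction_def encode_ccv_instance_def)
qed

lemma wf_network:
  assumes w: "w < n" and g: "g \<in> set (network n M W w)"
  shows "wf_cgate (num_wires n) g"
proof -
  have chain: "chain n p u < num_wires n" if "p < 2 * n" "u < chain_len n" for p u
    using chain_less[OF that] wire_bounds[of n] by simp
  have cell: "cell n p q < num_wires n" if "p < 2 * n" "q < n" for p q
    using cell_less[OF that] wire_bounds[of n] by simp
  obtain i where i: "i < num_cgates n" "g = network_gate n M W w i"
    using g by (auto simp: network_def)
  from i(1) show ?thesis
  proof (cases rule: phase_cases)
    case 1
    let ?m = "i mod (n * n) div n" let ?w = "i mod n" let ?t = "i div (n * n)"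
    have "0 < n" using w by simp
    then have "i mod (n * n) < n * n" by (intro mod_less_divisor) simp
    then have mw: "?m < n" "?w < n" using \<open>0 < n\<close> digits_bounds(1) by auto
    then have "rounds n - ?t + mrank ?m ?w < chain_len n" "rounds n - ?t + wrank ?w ?m < chain_len n"
      using pref_table_rank(1)[OF M mw] pref_table_rank(1)[OF W mw(2,1)] by (auto simp: chain_len_def)
    then show ?thesis
      using i 1 mw by (simp add: network_gate_def by_phase_simps Let_def chain chain_eq_iff)
  next
    case (2 x)
    then have x: "x div n < 2 * n" "x mod n < n" using digits_bounds by blast+
    then have "chain n (x div n) (x mod n) < cell_base n"
      by (intro chain_less) (simp_all only: chain_len_def trans_less_add2)
    moreover have "(M @ W) ! (x div n) ! (x mod n) < n" using pref_table_nth_append(1) x by blast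
    moreover have "cell_base n \<le> cell n (x div n) ((M @ W) ! (x div n) ! (x mod n))" by (rule cell_ge)
    ultimately show ?thesis
      using i 2 x wire_bounds[of n] by (auto simp: network_gate_def by_phase_simps cell)
  next
    case (3 x)
    then show ?thesis using i
      by (simp add: network_gate_def by_phase_simps num_wires_def result_base_def)
  next
    case (4 x)
    then have "x div n < n" "x mod n < n" using digits_bounds by blast+
    then show ?thesis using i 4 cell[of "n + x mod n" "x div n"]
      by (simp only: network_gate_def by_phase_simps(4))
        (simp add: num_wires_def result_base_def cell_def algebra_simps)
  next
    case (5 x)
    then show ?thesis using i w cell_less[of x n w] cell[of x w]
      by (simp only: network_gate_def by_phase_simps(5)) (simp add: num_wires_def)
  qed
qed

end

section \<open>A well-formed output forces a well-formed input\<close>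

lemma encode_cgate_parts:
  assumes "wf_cgate k g" "encode_cgate k g = b # xs @ ys" "length xs = k" "length ys = k"
  shows "(\<exists>i<k. xs = block k i) \<and> (if b then ys = replicate k False else \<exists>j<k. ys = block k j)"
  using assms by (cases g) (auto simp: length_block)

text \<open>Every field of the input feeds some type bit, gate address or the designated wire, and
  the shape of \<open>encode_ccv_instance\<close> restricts each of these. So a length of the right
  form is the only property of the input that has to be known beforehand.\<close>

lemma encodes_if_reduction_wf:
  assumes len: "length X = instance_length n"
    and eq: "reduction n X = encode_ccv_instance gs v c"
    and wf: "\<forall>g\<in>set gs. wf_cgate (length v) g" and c: "c < length v"
  shows "\<exists>M W m w. pref_table n M \<and> pref_table n W \<and> m < n \<and> w < n \<and> encodes n M W m w X"
proof -
  let ?k = "num_wires n"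
  let ?G = "num_cgates n"
  let ?C = "map (\<lambda>y. source_bit X (designated_source n y)) [0..<?k]"
  define F where "F g = map (\<lambda>y. source_bit X (fst_source n g y)) [0..<?k]" for g
  define S where "S g = map (\<lambda>y. source_bit X (snd_source n g y)) [0..<?k]" for g
  have sizes: "length v = ?k" "length gs = ?G"
    and eq': "concat (map (gate_bits n X) [0..<?G]) @
      map (\<lambda>y. source_bit X (initial_source n y)) [0..<?k] @ ?C =
      concat (map (encode_cgate ?k) gs) @ v @ block ?k c"
    using eq by (auto simp: reduction_def encode_ccv_instance_def unary_append_eq_iff)
  have "length (concat (map (gate_bits n X) [0..<?G])) = ?G * (2 * ?k + 1)"
    by (subst length_concat_uniform[of _ "2 * ?k + 1"]) (auto simp: length_gate_bits)
  moreover have "length (concat (map (encode_cgate ?k) gs)) = ?G * (2 * ?k + 1)"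
    by (subst length_concat_uniform[of _ "2 * ?k + 1"]) (auto simp: length_encode_cgate sizes)
  ultimately have gates: "concat (map (gate_bits n X) [0..<?G]) = concat (map (encode_cgate ?k) gs)"
    and C: "?C = block ?k c"
    using eq' sizes by auto
  have "map (gate_bits n X) [0..<?G] = map (encode_cgate ?k) gs"
    using gates sizes by (subst (asm) concat_map_eq_iff) (auto simp: length_encode_cgate length_gate_bits)
  then have gate: "encode_cgate ?k (gs ! g) = source_bit X (type_source n g) # F g @ S g" if "g < ?G" for g
    using that sizes by (auto simp: list_eq_iff_nth_eq[of "map _ _"] gate_bits_def F_def S_def)
  have parts: "\<exists>i<?k. F g = block ?k i"
    "if source_bit X (type_source n g) then S g = replicate ?k False else \<exists>j<?k. S g = block ?k j"
    if "g < ?G" for g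
    using encode_cgate_parts[OF _ gate[OF that]] wf that sizes by (auto simp: F_def S_def)
  \<comment> \<open>For \<open>n = 0\<close> there is no wire to designate. Consequently round 0
    exists, whose gates are used for the columns below.\<close>
  have n: "0 < n" using c sizes by (auto intro!: gr0I simp: num_wires_def result_base_def cell_base_def)
  then have T: "0 < rounds n" by (simp add: rounds_def)

  \<comment> \<open>The first gate of the last phase has a constant, nonzero second address, so it
    cannot carry the type bit of a negation.\<close>
  have stop: "\<not> source_bit X (n + 2)"
  proof
    assume "source_bit X (n + 2)"
    let ?g = "rounds n * (n * n) + 2 * n * n + n * n + n * n + 0"
    have "S ?g = replicate ?k False"
      using parts(2)[OF phase_less(5)[OF n]] \<open>source_bit X (n + 2)\<close> n
      by (simp only: type_source_def by_phase_simps if_True)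
    moreover have "S ?g ! result_base n"
      using n by (simp only: S_def snd_source_def by_phase_simps block_window_single)
        (simp add: nth_block num_wires_def)
    ultimately show False using n by (simp add: num_wires_def)
  qed
  \<comment> \<open>Gate \<open>i * n\<close> of the negation phase takes its type from size bit
    \<open>i\<close>. Its second address is all False, which is impossible for a comparator.\<close>
  have size: "source_bit X (i + 2)" if "i < n" for i
  proof (rule ccontr)
    assume "\<not> source_bit X (i + 2)"
    have x: "i * n < n * n" using that by simp
    let ?g = "rounds n * (n * n) + 2 * n * n + i * n"
    have "\<not> source_bit X (type_source n ?g)"
      using \<open>\<not> source_bit X (i + 2)\<close> n by (simp only: type_source_def by_phase_simps(3)[OF x]) simp
    then obtain j where "j < ?k" "S ?g = block ?k j" using parts(2)[OF phase_less(3)[OF x]] by auto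
    moreover have "S ?g = map (\<lambda>_. False) [0..<?k]"
      unfolding S_def snd_source_def by_phase_simps(3)[OF x] by (simp add: source_bit_const)
    ultimately have "map (\<lambda>_. False) [0..<?k] ! j" using nth_block[of j ?k j] by metis
    then show False using \<open>j < ?k\<close> by simp
  qed

  define B where "B p r q = source_bit X (table_source n p r q)" for p r q
  have bounds: "chain n p u + n \<le> ?k" if "p < 2 * n" "u \<le> rounds n" for p u
  proof -
    have "chain n p (u + (n - 1)) < cell_base n" using that n by (intro chain_less) (auto simp: chain_len_def)
    then show ?thesis using n wire_bounds[of n] by (simp add: chain_def)
  qed
  have cell_bounds: "cell n p 0 + n \<le> ?k" if "p < 2 * n" for p
    using cell_less[OF that, of "n - 1"] n wire_bounds[of n] by (simp add: cell_def)
  \<comment> \<open>In round 0, the gate for a pair has the man's column in its first address and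
    the woman's in its second. The latter is an address only for comparators, hence
    \<open>stop\<close> is used for the women.\<close>
  have column: "\<exists>r<n. \<forall>x<n. B p x q \<longleftrightarrow> x = r" if "p < 2 * n" "q < n" for p q
  proof -
    have B: "B p x q = source_bit X (table_source n p 0 q + x * n)" for x
      by (simp add: B_def table_source_def algebra_simps)
    show ?thesis
    proof (cases "p < n")
      case True
      let ?g = "p * n + q"
      have g': "?g < n * n" using True that by (intro digits_less)
      also have "\<dots> \<le> rounds n * (n * n)" using T by simp
      finally have g: "?g < rounds n * (n * n)" .
      have "?g mod (n * n) div n = p" "?g div (n * n) = 0" "?g mod n = q"
        using g' that by simp_all
      then have "F ?g = map (\<lambda>y. source_bit X (window (chain n p (rounds n)) n (table_source n p 0 q) n y)) [0..<?k]"
        by (simp add: F_def fst_source_def by_phase_simps(1)[OF g])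
      then show ?thesis
        unfolding B using parts(1)[OF phase_less(1)[OF g]] block_windowD bounds[OF that(1)] by (metis le_refl)
    next
      case False
      let ?w = "p - n"
      let ?g = "q * n + ?w"
      have w: "?w < n" "n + ?w = p" using False that by auto
      have g': "?g < n * n" using w that by (intro digits_less)
      also have "\<dots> \<le> rounds n * (n * n)" using T by simp
      finally have g: "?g < rounds n * (n * n)" .
      have idx: "?g mod (n * n) div n = q" "?g div (n * n) = 0" "?g mod n = ?w"
        using g' w(1) by simp_all
      have "S ?g = map (\<lambda>y. source_bit X (window (chain n p (rounds n)) n (table_source n p 0 q) n y)) [0..<?k]"
        unfolding S_def snd_source_def by_phase_simps(1)[OF g] idx w(2) by simp
      moreover have "\<exists>j<?k. S ?g = block ?k j"
        using parts(2)[OF phase_less(1)[OF g]] stop by (simp add: type_source_def by_phase_simps(1)[OF g])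
      ultimately show ?thesis
        unfolding B using block_windowD bounds[OF that(1)] by (metis le_refl)
    qed
  qed
  \<comment> \<open>The rows occur in the second addresses of the gates that move the state to the
    cells.\<close>
  have row: "\<exists>q<n. \<forall>x<n. B p r x \<longleftrightarrow> x = q" if "p < 2 * n" "r < n" for p r
  proof -
    let ?x = "p * n + r"
    let ?g = "rounds n * (n * n) + ?x"
    have x: "?x < 2 * n * n" using digits_less[OF that] by simp
    have idx: "?x div n = p" "?x mod n = r" using that by auto
    have B: "B p r y = source_bit X (table_source n p r 0 + y * 1)" for y
      by (simp add: B_def table_source_def)
    have "S ?g = map (\<lambda>y. source_bit X (window (cell n p 0) n (table_source n p r 0) 1 y)) [0..<?k]"
      unfolding S_def snd_source_def by_phase_simps(2)[OF x] idx by simp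
    moreover have "\<exists>j<?k. S ?g = block ?k j"
      using parts(2)[OF phase_less(2)[OF x]] stop by (simp add: type_source_def by_phase_simps(2)[OF x])
    ultimately show ?thesis
      unfolding B using block_windowD cell_bounds[OF that(1)] by metis
  qed
  obtain w where w: "w < n" "\<forall>x<n. source_bit X (woman_source n + x * 1) \<longleftrightarrow> x = w"
  proof -
    let ?g = "rounds n * (n * n) + 2 * n * n + n * n + n * n + 0"
    have "F ?g = map (\<lambda>y. source_bit X (window (cell n 0 0) n (woman_source n) 1 y)) [0..<?k]"
      unfolding F_def fst_source_def by_phase_simps(5)[OF n] by simp
    then show thesis
      using parts(1)[OF phase_less(5)[OF n]] block_windowD cell_bounds[of 0] that n by (metis mult_pos_pos zero_less_numeral)
  qed
  obtain m where m: "m < n" "\<forall>x<n. source_bit X (man_source n + x * 1) \<longleftrightarrow> x = m"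
    using block_windowD[OF C[unfolded designated_source_def]] c sizes by (auto simp: num_wires_def)

  obtain f where f: "\<And>p r. p < 2 * n \<Longrightarrow> r < n \<Longrightarrow> f p r < n"
    "\<And>p r q. p < 2 * n \<Longrightarrow> r < n \<Longrightarrow> q < n \<Longrightarrow> B p r q \<longleftrightarrow> q = f p r"
    using row by metis
  define L where "L p = map (f p) [0..<n]" for p
  \<comment> \<open>One-hot rows make \<open>f p\<close> a function on positions, one-hot columns
    make it injective, and finiteness makes it onto.\<close>
  have L: "distinct (L p) \<and> set (L p) = {..<n}" if "p < 2 * n" for p
  proof -
    have inj: "inj_on (f p) {0..<n}"
    proof (rule inj_onI)
      fix r r' assume r: "r \<in> {0..<n}" "r' \<in> {0..<n}" "f p r = f p r'"
      then have "B p r (f p r)" "B p r' (f p r)" using f that by auto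
      then show "r = r'" using column[OF that, of "f p r"] f(1)[OF that, of r] r by auto
    qed
    moreover have "f p ` {0..<n} = {..<n}"
      using inj f(1)[OF that] by (intro card_subset_eq) (auto simp: card_image)
    ultimately show ?thesis by (simp add: L_def distinct_map)
  qed
  define M where "M = map L [0..<n]"
  define W where "W = map (\<lambda>p. L (n + p)) [0..<n]"
  have MW: "M @ W = map L [0..<2 * n]"
    using map_upt_add[of L n n] by (simp add: M_def W_def mult_2)
  have "pref_table n M" "pref_table n W"
    using L by (auto simp: pref_table_def M_def W_def)
  moreover have "encodes n M W m w X"
    unfolding encodes_def MW using len size stop m(2) w(2) f
    by (auto simp: B_def L_def)
  ultimately show ?thesis using m(1) w(1) by blast
qed

section \<open>Correctness\<close>

definition size_of_length :: "nat \<Rightarrow> nat" where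
  "size_of_length N = (if N \<in> range instance_length then inv instance_length N else 0)"

text \<open>The default value 0 of \<open>size_of_length\<close> does not reveal that a length is
  invalid, so the length is tested again. Invalid lengths give the empty output, which is not in
  \<open>CcvNeg\<close>.\<close>

definition reduced_length :: "nat \<Rightarrow> nat" where
  "reduced_length N =
    (if instance_length (size_of_length N) = N then output_length (size_of_length N) else 0)"

lemma inj_instance_length: "inj instance_length"
proof (rule strict_mono_imp_inj_on[OF strict_monoI])
  fix a b :: nat assume "a < b"
  moreover then have "2 * a * a * a \<le> 2 * b * b * b" by (intro mult_mono) auto
  ultimately show "instance_length a < instance_length b"
    unfolding instance_length_def by linarith
qed

lemma size_of_instance_length [simp]: "size_of_length (instance_length n) = n"
  by (simp add: size_of_length_def inj_instance_length)

lemma reduced_length_instance_length [simp]: "reduced_length (instance_length n) = output_length n"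
  by (simp add: reduced_length_def)

lemma reduced_length_eq_0: "\<nexists>n. N = instance_length n \<Longrightarrow> reduced_length N = 0"
  unfolding reduced_length_def by metis

lemma definable_size_of_length:
  "definable_fun h \<Longrightarrow> definable_fun (\<lambda>e. size_of_length (h e))"
  unfolding size_of_length_def
  by (intro definable_fun_preimage inj_instance_length definable_sizes definable_fun_var)
    (simp_all add: instance_length_def)

lemma definable_reduced_length: "definable_fun (\<lambda>e. reduced_length (e 0))"
  unfolding reduced_length_def
  by (intro definable_intros definable_sizes definable_size_of_length)

lemma reduction_mem_CcvNeg_iff:
  assumes "pref_table n M" "pref_table n W" "m < n" "w < n" "encodes n M W m w X"
  shows "reduction n X \<in> CcvNeg \<longleftrightarrow> (\<exists>P. man_optimal n M W P \<and> (m, w) \<in> P)"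
proof -
  interpret stable_marriage n M W using assms by unfold_locales
  let ?gs = "network n M W w" and ?v = "initial_wires n" and ?c = "result_base n + m"
  have eq: "reduction n X = encode_ccv_instance ?gs ?v ?c"
    using assms by (intro reduction_encodes)
  have len: "length ?v = num_wires n" by (simp add: initial_wires_def)
  have wf: "\<forall>g\<in>set ?gs. wf_cgate (length ?v) g" "?c < length ?v"
    using wf_network[OF assms(4)] assms(3) len by (auto simp: num_wires_def)
  have "reduction n X \<in> CcvNeg \<longleftrightarrow> fold apply_cgate ?gs ?v ! ?c"
  proof
    assume "reduction n X \<in> CcvNeg"
    then obtain gs v c where *: "encode_ccv_instance ?gs ?v ?c = encode_ccv_instance gs v c"
      "fold apply_cgate gs v ! c"
      unfolding CcvNeg_def eq by blast
    then show "fold apply_cgate ?gs ?v ! ?c"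
      using encode_ccv_instance_eqD[OF *(1) wf] by simp
  next
    assume "fold apply_cgate ?gs ?v ! ?c"
    then show "reduction n X \<in> CcvNeg" unfolding CcvNeg_def eq using wf by blast
  qed
  then show ?thesis using network_correct[OF assms(3,4)] by simp
qed

lemma pref_table_encodes_iff:
  "(pref_table n M \<and> pref_table n W \<and> m < n \<and> w < n \<and> encodes n M W m w X \<and> Q) \<longleftrightarrow>
    X = encode_marriage_instance n M W m w \<and> pref_table n M \<and> pref_table n W \<and> m < n \<and> w < n \<and> Q"
  using encodes_iff[of n M W m w X] pref_table_is_table by blast

lemma MoSm_eq:
  "MoSm = {X. \<exists>n M W m w. pref_table n M \<and> pref_table n W \<and> m < n \<and> w < n \<and> encodes n M W m w X \<and>
     (\<exists>P. man_optimal n M W P \<and> (m, w) \<in> P)}"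
  unfolding MoSm_def pref_table_encodes_iff ..

lemma reduction_correct:
  assumes len: "length X = instance_length n"
  shows "X \<in> MoSm \<longleftrightarrow> reduction n X \<in> CcvNeg"
proof
  assume "X \<in> MoSm"
  then obtain n' M W m w where *: "pref_table n' M" "pref_table n' W" "m < n'" "w < n'"
    "encodes n' M W m w X" "\<exists>P. man_optimal n' M W P \<and> (m, w) \<in> P"
    unfolding MoSm_eq by blast
  then have "instance_length n' = instance_length n" using len by (simp add: encodes_def)
  then have "n' = n" using inj_instance_length by (simp add: inj_eq)
  then show "reduction n X \<in> CcvNeg" using * reduction_mem_CcvNeg_iff by blast
next
  assume X: "reduction n X \<in> CcvNeg"
  then obtain gs v c where "reduction n X = encode_ccv_instance gs v c"
    "\<forall>g\<in>set gs. wf_cgate (length v) g" "c < length v"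
    unfolding CcvNeg_def by blast
  from encodes_if_reduction_wf[OF len this] obtain M W m w where
    *: "pref_table n M" "pref_table n W" "m < n" "w < n" "encodes n M W m w X"
    by blast
  then have "\<exists>P. man_optimal n M W P \<and> (m, w) \<in> P" using X reduction_mem_CcvNeg_iff by simp
  with * show "X \<in> MoSm" unfolding MoSm_eq by blast
qed

lemma Nil_notin_CcvNeg: "[] \<notin> CcvNeg"
  by (auto simp: CcvNeg_def encode_ccv_instance_def unary_def)

lemma length_MoSm: "X \<in> MoSm \<Longrightarrow> \<exists>n. length X = instance_length n"
  unfolding MoSm_eq by (auto simp: encodes_def)

lemma MoSm_reducible: "AC0_many_one_reducible MoSm CcvNeg"
proof -
  define src where "src N j = output_source (size_of_length N) j" for N j
  define F where "F X = map (\<lambda>j. source_bit X (src (length X) j)) [0..<reduced_length (length X)]" for X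
  have "uniform_AC0_computable F"
    unfolding F_def src_def
    by (intro projection_uniform_AC0[where src = "\<lambda>N j. output_source (size_of_length N) j"]
        definable_reduced_length definable_output_source definable_size_of_length definable_fun_var)
  moreover have "X \<in> MoSm \<longleftrightarrow> F X \<in> CcvNeg" for X
  proof (cases "\<exists>n. length X = instance_length n")
    case True
    then obtain n where n: "length X = instance_length n" by blast
    then have "F X = reduction n X" by (simp add: F_def src_def reduction_eq_map)
    then show ?thesis using reduction_correct[OF n] by simp
  next
    case False
    then have "F X = []" by (simp add: F_def reduced_length_eq_0)
    then show ?thesis using False length_MoSm Nil_notin_CcvNeg by auto
  qed
  ultimately show ?thesis unfolding AC0_many_one_reducible_def by blast
qed

section \<open>Exchanging the sexes\<close>

text \<open>Acts on sources rather than input positions, fixing the two constants and the size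
  field, so that it composes with \<open>output_source\<close>. It exchanges the two tables and the
  two designated blocks.\<close>

definition swap_source :: "nat \<Rightarrow> nat \<Rightarrow> nat" where
  "swap_source n i = (if i < n + 3 then i
     else if i < n + 3 + n * n * n then i + n * n * n
     else if i < n + 3 + 2 * n * n * n then i - n * n * n
     else if i < woman_source n then i + n
     else if i < woman_source n + n then i - n
     else i)"

definition swap_instance :: "nat \<Rightarrow> bool list \<Rightarrow> bool list" where
  "swap_instance n X = map (\<lambda>i. source_bit X (swap_source n (i + 2))) [0..<instance_length n]"

lemma swap_source_table:
  assumes "r < n" "q < n"
  shows "p < n \<Longrightarrow> swap_source n (table_source n p r q) = table_source n (n + p) r q"
    "p < n \<Longrightarrow> swap_source n (table_source n (n + p) r q) = table_source n p r q"
proof -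
  assume p: "p < n"
  have i: "(p * n + r) * n + q < n * n * n" using p assms by (intro digits_less)
  have shift: "table_source n (n + p) r q = table_source n p r q + n * n * n"
    by (simp add: table_source_def algebra_simps)
  show "swap_source n (table_source n p r q) = table_source n (n + p) r q"
    unfolding shift using i by (simp add: swap_source_def table_source_def)
  show "swap_source n (table_source n (n + p) r q) = table_source n p r q"
    unfolding shift using i by (simp add: swap_source_def table_source_def)
qed

lemma swap_source_swap_source:
  assumes "i < instance_length n"
  shows "swap_source n (swap_source n (i + 2)) = i + 2"
  using assms
proof (cases rule: instance_source_cases)
  case (table p r q)
  show ?thesis
  proof (cases "p < n")
    case True
    then show ?thesis using table swap_source_table by simp
  next
    case False
    then have "p - n < n" "n + (p - n) = p" using table by auto
    then show ?thesis using table swap_source_table[OF table(2,3), of "p - n"] by simp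
  qed
qed (auto simp: swap_source_def man_source_def woman_source_def)

lemma source_bit_swap_instance:
  assumes "length X = instance_length n"
  shows "source_bit (swap_instance n X) i \<longleftrightarrow> source_bit X (swap_source n i)"
proof -
  consider "i = 0" | "i = 1" | "2 \<le> i" "i < instance_length n + 2" | "instance_length n + 2 \<le> i"
    by linarith
  then show ?thesis
  proof cases
    case 3
    then have "source_bit (swap_instance n X) i = swap_instance n X ! (i - 2)"
      by (intro source_bit_nth) (simp_all add: swap_instance_def)
    also have "\<dots> \<longleftrightarrow> source_bit X (swap_source n i)"
      using 3 le_add_diff_inverse2[OF 3(1)] by (simp add: swap_instance_def less_diff_conv2 del: add_2_eq_Suc')
    finally show ?thesis .
  next
    case 4
    then have "swap_source n i = i"
      by (simp add: swap_source_def instance_length_def woman_source_def)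
    moreover have "\<not> i - 2 < instance_length n" using 4 by simp
    ultimately show ?thesis using assms by (simp add: source_bit_def swap_instance_def)
  qed (auto simp: swap_source_def source_bit_const)
qed

text \<open>The involution yields the converse in \<open>WoSm_iff_swap_instance\<close>: an input
  whose exchanged form is a valid instance is itself the exchange of that instance, hence
  valid.\<close>

lemma swap_instance_swap_instance:
  assumes "length X = instance_length n" shows "swap_instance n (swap_instance n X) = X"
proof (rule nth_equalityI)
  show "length (swap_instance n (swap_instance n X)) = length X"
    using assms by (simp add: swap_instance_def)
  fix i assume i: "i < length (swap_instance n (swap_instance n X))"
  then have i: "i < instance_length n" by (simp add: swap_instance_def)
  then have "swap_instance n (swap_instance n X) ! i = source_bit (swap_instance n X) (swap_source n (i + 2))"
    by (subst swap_instance_def) simp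
  also have "\<dots> = source_bit X (i + 2)"
    unfolding source_bit_swap_instance[OF assms] swap_source_swap_source[OF i] ..
  also have "\<dots> = X ! i" using i assms by (simp add: source_bit_nth)
  finally show "swap_instance n (swap_instance n X) ! i = X ! i" .
qed

lemma encodes_swap_instance:
  assumes "encodes n M W m w X" "length M = n" "length W = n"
  shows "encodes n W M w m (swap_instance n X)"
proof -
  have len: "length X = instance_length n" using assms by (simp add: encodes_def)
  note bit = source_bit_swap_instance[OF len]
  have X: "\<And>i. i < n \<Longrightarrow> source_bit X (i + 2)" "\<not> source_bit X (n + 2)"
    "\<And>p r q. p < 2 * n \<Longrightarrow> r < n \<Longrightarrow> q < n \<Longrightarrow> source_bit X (table_source n p r q) \<longleftrightarrow> (M @ W) ! p ! r = q"
    "\<And>q. q < n \<Longrightarrow> source_bit X (man_source n + q) \<longleftrightarrow> q = m"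
    "\<And>q. q < n \<Longrightarrow> source_bit X (woman_source n + q) \<longleftrightarrow> q = w"
    using assms(1) unfolding encodes_def by blast+
  show ?thesis
    unfolding encodes_def bit
  proof (intro conjI allI impI)
    show "length (swap_instance n X) = instance_length n" by (simp add: swap_instance_def)
    show "source_bit X (swap_source n (i + 2))" if "i < n" for i
      using X(1)[OF that] that by (simp add: swap_source_def)
    show "\<not> source_bit X (swap_source n (n + 2))"
      using X(2) by (simp add: swap_source_def)
    show "source_bit X (swap_source n (table_source n p r q)) \<longleftrightarrow> (W @ M) ! p ! r = q"
      if "p < 2 * n" "r < n" "q < n" for p r q
    proof (cases "p < n")
      case True
      then show ?thesis using swap_source_table(1)[OF that(2,3)] X(3)[of "n + p" r q] that assms(2,3)
        by (simp add: nth_append)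
    next
      case False
      then have "p - n < n" "n + (p - n) = p" using that by auto
      then show ?thesis using swap_source_table(2)[OF that(2,3), of "p - n"] X(3)[of "p - n" r q]
          that assms(2,3) False \<open>p - n < n\<close> by (simp add: nth_append)
    qed
    show "source_bit X (swap_source n (man_source n + q)) \<longleftrightarrow> q = w" if "q < n" for q
    proof -
      have "swap_source n (man_source n + q) = woman_source n + q"
        using that by (simp add: swap_source_def man_source_def woman_source_def)
      then show ?thesis using X(5)[OF that] by simp
    qed
    show "source_bit X (swap_source n (woman_source n + q)) \<longleftrightarrow> q = m" if "q < n" for q
    proof -
      have "swap_source n (woman_source n + q) = man_source n + q"
        using that by (simp add: swap_source_def man_source_def woman_source_def)
      then show ?thesis using X(4)[OF that] by simp
    qed
  qed
qed

lemma stable_converse: "stable n M W P \<Longrightarrow> stable n W M (P\<inverse>)"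
  unfolding stable_def marriage_def by blast

lemma woman_optimal_imp_man_optimal: "woman_optimal n M W P \<Longrightarrow> man_optimal n W M (P\<inverse>)"
  unfolding woman_optimal_def man_optimal_def
  using stable_converse[of n M W] stable_converse[of n W M] by (metis converse_iff)

lemma man_optimal_imp_woman_optimal: "man_optimal n W M P \<Longrightarrow> woman_optimal n M W (P\<inverse>)"
  unfolding woman_optimal_def man_optimal_def
  using stable_converse[of n M W] stable_converse[of n W M] by (metis converse_iff)

text \<open>Stability is symmetric in the sexes, so taking converses matches woman-optimal marriages
  with the man-optimal ones of the exchanged tables.\<close>

lemma woman_optimal_pair_iff:
  "(\<exists>P. woman_optimal n M W P \<and> (m, w) \<in> P) \<longleftrightarrow> (\<exists>P. man_optimal n W M P \<and> (w, m) \<in> P)"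
  using woman_optimal_imp_man_optimal man_optimal_imp_woman_optimal by (metis converse_iff)

lemma WoSm_eq:
  "WoSm = {X. \<exists>n M W m w. pref_table n M \<and> pref_table n W \<and> m < n \<and> w < n \<and> encodes n M W m w X \<and>
     (\<exists>P. man_optimal n W M P \<and> (w, m) \<in> P)}"
  unfolding WoSm_def woman_optimal_pair_iff pref_table_encodes_iff ..

lemma length_WoSm: "X \<in> WoSm \<Longrightarrow> \<exists>n. length X = instance_length n"
  unfolding WoSm_eq by (auto simp: encodes_def)

lemma encodes_size: "encodes n' M W m w X \<Longrightarrow> length X = instance_length n \<Longrightarrow> n' = n"
  using inj_instance_length by (simp add: encodes_def inj_eq)

lemma WoSm_iff_swap_instance:
  assumes len: "length X = instance_length n"
  shows "X \<in> WoSm \<longleftrightarrow> swap_instance n X \<in> MoSm"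
proof
  assume "X \<in> WoSm"
  then obtain n' M W m w where *: "pref_table n' M" "pref_table n' W" "m < n'" "w < n'"
    "encodes n' M W m w X" "\<exists>P. man_optimal n' W M P \<and> (w, m) \<in> P"
    unfolding WoSm_eq by blast
  then have n: "n' = n" using encodes_size len by blast
  have "encodes n W M w m (swap_instance n X)"
    by (rule encodes_swap_instance) (use * n in \<open>auto simp: pref_table_def\<close>)
  then show "swap_instance n X \<in> MoSm" using * n unfolding MoSm_eq by blast
next
  assume "swap_instance n X \<in> MoSm"
  then obtain n' M W m w where *: "pref_table n' M" "pref_table n' W" "m < n'" "w < n'"
    "encodes n' M W m w (swap_instance n X)" "\<exists>P. man_optimal n' M W P \<and> (m, w) \<in> P"
    unfolding MoSm_eq by blast
  have "length (swap_instance n X) = instance_length n" by (simp add: swap_instance_def)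
  then have n: "n' = n" using encodes_size *(5) by blast
  have "encodes n W M w m (swap_instance n (swap_instance n X))"
    by (rule encodes_swap_instance) (use * n in \<open>auto simp: pref_table_def\<close>)
  then show "X \<in> WoSm"
    using * n unfolding swap_instance_swap_instance[OF len] WoSm_eq by blast
qed

lemma definable_swap_source:
  "definable_fun n \<Longrightarrow> definable_fun i \<Longrightarrow> definable_fun (\<lambda>e. swap_source (n e) (i e))"
  unfolding swap_source_def by (intro definable_intros definable_sizes)

lemma WoSm_reducible: "AC0_many_one_reducible WoSm CcvNeg"
proof -
  \<comment> \<open>Exchanging first and reducing afterwards is again a projection: the two source
    maps are composed.\<close>
  define src where "src N j = swap_source (size_of_length N) (output_source (size_of_length N) j)" for N j
  define F where "F X = map (\<lambda>j. source_bit X (src (length X) j)) [0..<reduced_length (length X)]" for X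
  have "uniform_AC0_computable F"
    unfolding F_def src_def
    by (intro projection_uniform_AC0[where src =
          "\<lambda>N j. swap_source (size_of_length N) (output_source (size_of_length N) j)"]
        definable_reduced_length definable_swap_source definable_output_source
        definable_size_of_length definable_fun_var)
  moreover have "X \<in> WoSm \<longleftrightarrow> F X \<in> CcvNeg" for X
  proof (cases "\<exists>n. length X = instance_length n")
    case True
    then obtain n where n: "length X = instance_length n" by blast
    then have "F X = reduction n (swap_instance n X)"
      by (simp add: F_def src_def reduction_eq_map source_bit_swap_instance)
    moreover have "length (swap_instance n X) = instance_length n" by (simp add: swap_instance_def)
    ultimately show ?thesis using reduction_correct WoSm_iff_swap_instance[OF n] by simp
  next
    case False
    then have "F X = []" by (simp add: F_def reduced_length_eq_0)
    then show ?thesis using False length_WoSm Nil_notin_CcvNeg by auto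
  qed
  ultimately show ?thesis unfolding AC0_many_one_reducible_def by blast
qed

theorem theorem49:
  "AC0_many_one_reducible MoSm CcvNeg \<and> AC0_many_one_reducible WoSm CcvNeg"
  using MoSm_reducible WoSm_reducible by blast

end
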